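(* Let $G$ be a bi-coloured graph and let $(G,p)$ be a completely regular framework on the unit sphere $\mathcal{S}=\{(x,y,z)\in\mathbb{R}^3 : x^2+y^2+z^2=1\}$ for Euclidean (blue) and geodesic (red) distances. Then the framework $(G,p)$ is minimally rigid on $\mathcal{S}$ if and only if $G$ is $(2,3)$-tight.
   Context: A bi-coloured graph $G=(V,E)$ is a finite multigraph, each of whose edges is coloured blue or red, whose monochrome subgraphs are simple graphs, possibly with loops; so between two distinct vertices there is at most one blue and at most one red edge. $K(V)$ denotes the complete bi-coloured graph on $V$, with two edges of distinct colours between each pair of distinct vertices and two loops of distinct colours at each vertex. $G$ is $(2,3)$-sparse if $|E'|\le 2|V'|-3$ for all subgraphs $(V',E')$ with $|E'|>0$ (parallel edges are counted with multiplicity), and $(2,3)$-tight if it is $(2,3)$-sparse and $|E|=2|V|-3$. A framework $(G,p)$ on $\mathcal{S}$ is a bi-coloured graph with a placement $p:V\to\mathcal{S}$, with $p(v)\ne p(w)$ if $vw$ is an edge with $v\neq w$; placements are taken at which the distance functions below are differentiable (for distinct vertices). A blue edge $vw$ constrains the Euclidean distance $d_b(p(v),p(w))=\|p(v)-p(w)\|_2$ in $\mathbb{R}^3$; a red edge $vw$ constrains the geodesic distance $d_g(p(v),p(w))$, the length of a shortest path on $\mathcal{S}$. (A loop has constant separation $0$ and so contributes a zero row to the rigidity matrix.) An infinitesimal flex of $(G,p)$ is an assignment of a tangent vector $u(v)\in T_{p(v)}\mathcal{S}$ to each $v\in V$ such that, to first order, no edge separation is changed. The rigidity matrix is the $|E|\times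 2|V|$ matrix of the linear system defining the infinitesimal flexes (the derivative of the map sending a placement to its tuple of edge separations). $(G,p)$ is (infinitesimally) rigid if every infinitesimal flex of $(G,p)$ is an infinitesimal flex of $(K(V),p)$. It is minimally rigid if it is rigid and, for every edge $e$, $(G-e,p)$ is not rigid. $(G,p)$ is completely regular if for every subgraph $H$ of $K(V)$ the rigidity matrix of $(H,p|_H)$ has maximal rank over all framework realisations of $H$ on $\mathcal{S}$.
   Formalization: The graph G is assumed to have at least two vertices; for a single vertex with no edges the framework is vacuously minimally rigid but |E| = 0 is not 2|V|-3 = -1. *)

theory Defs
  imports "HOL-Analysis.Analysis" "HOL-Library.Function_Algebras"
begin

datatype colour = Blue | Red

text \<open>An edge is a colour together with its set of ends; a loop has a singleton set of ends.
  Two edges with the same ends therefore have distinct colours.\<close>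

type_synonym 'v edge = "colour \<times> 'v set"

definition complete_edges :: "'v set \<Rightarrow> 'v edge set" where
  "complete_edges V = {(c, {v, w}) | c v w. v \<in> V \<and> w \<in> V}"

definition bicoloured_graph :: "'v set \<Rightarrow> 'v edge set \<Rightarrow> bool" where
  "bicoloured_graph V E \<longleftrightarrow> finite V \<and> E \<subseteq> complete_edges V"

definition subgraph :: "'v set \<Rightarrow> 'v edge set \<Rightarrow> 'v set \<Rightarrow> 'v edge set \<Rightarrow> bool" where
  "subgraph V' E' V E \<longleftrightarrow> bicoloured_graph V' E' \<and> V' \<subseteq> V \<and> E' \<subseteq> E"

definition sparse_2_3 :: "'v set \<Rightarrow> 'v edge set \<Rightarrow> bool" where
  "sparse_2_3 V E \<longleftrightarrow>
    (\<forall>V' E'. subgraph V' E' V E \<and> card E' > 0 \<longrightarrow> int (card E') \<le> 2 * int (card V') - 3)"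

definition tight_2_3 :: "'v set \<Rightarrow> 'v edge set \<Rightarrow> bool" where
  "tight_2_3 V E \<longleftrightarrow> sparse_2_3 V E \<and> int (card E) = 2 * int (card V) - 3"

abbreviation S2 :: "(real ^ 3) set" where
  "S2 \<equiv> sphere 0 1"

text \<open>Piecewise \<open>C\<^sup>1\<close> paths are only required to be continuous at the exceptional parameters, so
  their length may be infinite; stating it with \<open>has_integral\<close> admits the rectifiable ones
  only.\<close>

definition has_length :: "(real \<Rightarrow> 'a::euclidean_space) \<Rightarrow> real \<Rightarrow> bool" where
  "has_length \<gamma> L \<longleftrightarrow> valid_path \<gamma> \<and>
    ((\<lambda>t. norm (vector_derivative \<gamma> (at t within {0..1}))) has_integral L) {0..1}"

definition geodesic_dist :: "'a::euclidean_space set \<Rightarrow> 'a \<Rightarrow> 'a \<Rightarrow> real" where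
  "geodesic_dist S x y =
    Inf {L. \<exists>\<gamma>. has_length \<gamma> L \<and> path_image \<gamma> \<subseteq> S \<and> pathstart \<gamma> = x \<and> pathfinish \<gamma> = y}"

fun separation :: "colour \<Rightarrow> (real ^ 3) \<times> (real ^ 3) \<Rightarrow> real" where
  "separation Blue (x, y) = dist x y"
| "separation Red (x, y) = geodesic_dist S2 x y"

text \<open>The separations are symmetric, so the order in which the ends of an edge are listed is
  immaterial.\<close>

definition ends :: "'v set \<Rightarrow> 'v \<times> 'v" where
  "ends e = (SOME (v, w). e = {v, w})"

definition framework :: "'v set \<Rightarrow> 'v edge set \<Rightarrow> ('v \<Rightarrow> real ^ 3) \<Rightarrow> bool" where
  "framework V E p \<longleftrightarrow> bicoloured_graph V E \<and> p ` V \<subseteq> S2 \<and>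
    (\<forall>c v w. (c, {v, w}) \<in> E \<and> v \<noteq> w \<longrightarrow>
      p v \<noteq> p w \<and> separation c differentiable (at (p v, p w) within S2 \<times> S2))"

definition tangent_fields :: "'v set \<Rightarrow> ('v \<Rightarrow> real ^ 3) \<Rightarrow> ('v \<Rightarrow> real ^ 3) set" where
  "tangent_fields V p = {u. \<forall>v\<in>V. p v \<bullet> u v = 0}"

text \<open>The first-order change of the separation of an edge under velocities \<open>u\<close>. A Frechet
  derivative within \<open>S2 \<times> S2\<close> is not unique as a linear map on the ambient space, but
  all of them agree on pairs of tangent vectors, and only these are used below.\<close>

fun separation_rate :: "('v \<Rightarrow> real ^ 3) \<Rightarrow> ('v \<Rightarrow> real ^ 3) \<Rightarrow> 'v edge \<Rightarrow> real" where
  "separation_rate p u (c, e) = (case ends e of (v, w) \<Rightarrow>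
    if v = w then 0
    else frechet_derivative (separation c) (at (p v, p w) within S2 \<times> S2) (u v, u w))"

definition inf_flex :: "'v set \<Rightarrow> 'v edge set \<Rightarrow> ('v \<Rightarrow> real ^ 3) \<Rightarrow> ('v \<Rightarrow> real ^ 3) \<Rightarrow> bool" where
  "inf_flex V E p u \<longleftrightarrow> u \<in> tangent_fields V p \<and> (\<forall>e\<in>E. separation_rate p u e = 0)"

definition rigid :: "'v set \<Rightarrow> 'v edge set \<Rightarrow> ('v \<Rightarrow> real ^ 3) \<Rightarrow> bool" where
  "rigid V E p \<longleftrightarrow> (\<forall>u. inf_flex V E p u \<longrightarrow> inf_flex V (complete_edges V) p u)"

definition minimally_rigid :: "'v set \<Rightarrow> 'v edge set \<Rightarrow> ('v \<Rightarrow> real ^ 3) \<Rightarrow> bool" where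
  "minimally_rigid V E p \<longleftrightarrow> rigid V E p \<and> (\<forall>e\<in>E. \<not> rigid V (E - {e}) p)"

text \<open>The rigidity matrix is the matrix, with respect to bases of the tangent planes, of the
  linear map \<open>rigidity_map E p\<close> from \<open>tangent_fields V p\<close> to the real functions on \<open>E\<close>
  (extended by zero to all edges). Its rank is the dimension of the image of that map.\<close>

definition rigidity_map ::
    "'v edge set \<Rightarrow> ('v \<Rightarrow> real ^ 3) \<Rightarrow> ('v \<Rightarrow> real ^ 3) \<Rightarrow> 'v edge \<Rightarrow> real" where
  "rigidity_map E p u = (\<lambda>e. if e \<in> E then separation_rate p u e else 0)"

interpretation fun_space: vector_space "\<lambda>(c::real) (f::'e \<Rightarrow> real) e. c * f e"
  by unfold_locales (auto simp: algebra_simps)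

definition rigidity_rank :: "'v set \<Rightarrow> 'v edge set \<Rightarrow> ('v \<Rightarrow> real ^ 3) \<Rightarrow> nat" where
  "rigidity_rank V E p = fun_space.dim (rigidity_map E p ` tangent_fields V p)"

definition completely_regular :: "'v set \<Rightarrow> ('v \<Rightarrow> real ^ 3) \<Rightarrow> bool" where
  "completely_regular V p \<longleftrightarrow>
    (\<forall>W F. subgraph W F V (complete_edges V) \<longrightarrow> framework W F p \<and>
      (\<forall>q. framework W F q \<longrightarrow> rigidity_rank W F q \<le> rigidity_rank W F p))"

end

theory Submission
  imports Defs
begin

text \<open>On the unit sphere the geodesic distance is \<open>arccos (x \<bullet> y)\<close>, so at distinct non-antipodal points
  the rates of both separations are nonzero multiples of \<open>p v \<bullet> u w + p w \<bullet> u v\<close>, and colours play no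
  role beyond making parallel edges dependent. Antipodal points are excluded, since the geodesic
  distance is not differentiable there. It remains to prove Laman's theorem on the sphere. Rotations
  give a three-dimensional space of trivial flexes, so independent edge sets are sparse and the
  rigid ones among them are those with \<open>2 |V| - 3\<close> edges. Conversely, a sparse graph is reduced by
  Henneberg moves at a vertex of degree at most 3; complete regularity allows the independence of
  the larger graph to be checked at a placement in which the new vertex is moved to a special
  position.\<close>

section \<open>Geodesic distance on the sphere\<close>

text \<open>No bases of tangent planes are chosen: rates are functionals on all fields
  \<open>'v => real ^ 3\<close>, and tangency becomes |V| further linear conditions. The bound comes
  from one count. The |E| rates, |V| radial components and 3 = dim SO(3) gauges are independent
  elements of the span of the 3|V| coordinate functionals, so |E| <= 2|V| - 3, and they fill that
  span exactly when equality holds. Two obstacles shape the Henneberg moves. Ranks may be compared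
  only with placements that are frameworks, so each special position must also avoid coincident and
  antipodal ends. The degree-3 move further needs its third neighbour off the great circle through
  the other two. The facts about \<open>p\<close> used here come from complete regularity on
  subgraphs of \<open>K(V)\<close>: red edges exclude antipodal pairs, and triangles exclude three
  points on a great circle. Two vertices at least are required: a single vertex without edges is
  minimally rigid, but 2 * 1 - 3 is negative.\<close>

lemma inner_sphere_derivative_bound:
  fixes x g d :: "'a::real_inner"
  assumes "norm x = 1" "norm g = 1" "g \<bullet> d = 0"
  shows "(x \<bullet> d)\<^sup>2 \<le> (1 - (x \<bullet> g)\<^sup>2) * (norm d)\<^sup>2"
proof -
  \<comment> \<open>The part of \<open>x\<close> orthogonal to \<open>g\<close>. Since
    \<open>d\<close> is orthogonal to \<open>g\<close>, it meets only this part, whose squared norm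
    is the factor in the bound.\<close>
  let ?h = "x - (x \<bullet> g) *\<^sub>R g"
  have "x \<bullet> d = ?h \<bullet> d"
    using assms(3) by (simp add: inner_diff_left)
  moreover have "(?h \<bullet> d)\<^sup>2 \<le> (?h \<bullet> ?h) * (d \<bullet> d)"
    by (rule Cauchy_Schwarz_ineq)
  moreover have "?h \<bullet> ?h = 1 - (x \<bullet> g)\<^sup>2"
    using assms(1,2) by (simp add: algebra_simps inner_commute power2_eq_square norm_eq_1)
  ultimately show ?thesis
    by (simp add: power2_norm_eq_inner)
qed

lemma sphere_velocity_orthogonal:
  fixes g :: "real \<Rightarrow> 'a::real_inner"
  assumes "(g has_vector_derivative d) (at t)" "open U" "t \<in> U" "\<And>s. s \<in> U \<Longrightarrow> norm (g s) = 1"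
  shows "g t \<bullet> d = 0"
proof -
  have "((\<lambda>s. g s \<bullet> g s) has_vector_derivative g t \<bullet> d + d \<bullet> g t) (at t)"
    using assms(1) by (auto simp: has_vector_derivative_def intro!: derivative_eq_intros)
      (auto simp: algebra_simps)
  moreover have "((\<lambda>s. g s \<bullet> g s) has_vector_derivative 0) (at t)"
    by (rule has_vector_derivative_transform_within_open[where f = "\<lambda>_. 1", OF _ assms(2,3)])
      (use assms(4) in \<open>auto simp: norm_eq_1\<close>)
  ultimately have "g t \<bullet> d + d \<bullet> g t = 0"
    using vector_derivative_at by metis
  then show ?thesis
    by (simp add: inner_commute)
qed

text \<open>The function \<open>arccos (x \<bullet> \<gamma> t)\<close> is not differentiable where the path meets \<open>x\<close> or \<open>- x\<close>;
  scaling the argument by \<open>c < 1\<close> removes these singularities.\<close>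

lemma scaled_angle_le_length:
  fixes \<gamma> :: "real \<Rightarrow> 'a::euclidean_space"
  assumes "has_length \<gamma> L" "path_image \<gamma> \<subseteq> sphere 0 1" "norm x = 1" "0 < c" "c < 1"
  shows "arccos (c * (x \<bullet> \<gamma> 1)) - arccos (c * (x \<bullet> \<gamma> 0)) \<le> L"
proof -
  define v where "v = (\<lambda>t. vector_derivative \<gamma> (at t within {0..1}))"
  have L: "((\<lambda>t. norm (v t)) has_integral L) {0..1}"
    using assms(1) by (simp add: has_length_def v_def)
  obtain S where S: "finite S" "\<gamma> C1_differentiable_on {0..1} - S" and cont: "continuous_on {0..1} \<gamma>"
    using assms(1) unfolding has_length_def valid_path_def piecewise_C1_differentiable_on_def by blast
  have on_sphere: "norm (\<gamma> t) = 1" if "t \<in> {0..1}" for t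
    using assms(2) that by (auto simp: path_image_def image_subset_iff)
  have der: "(\<gamma> has_vector_derivative v t) (at t)" if "t \<in> {0<..<1} - S" for t
  proof -
    have "\<gamma> differentiable at t"
      using S(2) that by (auto simp: C1_differentiable_on_eq)
    then have "(\<gamma> has_vector_derivative vector_derivative \<gamma> (at t)) (at t)"
      by (simp add: vector_derivative_works)
    moreover from this have "v t = vector_derivative \<gamma> (at t)"
      unfolding v_def using that by (intro vector_derivative_at_within_ivl) auto
    ultimately show ?thesis by simp
  qed
  have bound: "\<bar>c * (x \<bullet> \<gamma> t)\<bar> < 1" if "t \<in> {0..1}" for t
  proof -
    have "\<bar>x \<bullet> \<gamma> t\<bar> \<le> 1"
      using Cauchy_Schwarz_ineq2[of x "\<gamma> t"] assms(3) on_sphere[OF that] by simp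
    then have "c * \<bar>x \<bullet> \<gamma> t\<bar> \<le> c" using assms(4) by simp
    then have "c * \<bar>x \<bullet> \<gamma> t\<bar> < 1" using assms(5) by linarith
    then show ?thesis using assms(4) by (simp add: abs_mult)
  qed
  define f where "f = (\<lambda>t. arccos (c * (x \<bullet> \<gamma> t)))"
  \<comment> \<open>The value 0 at the exceptional parameters is a placeholder: the fundamental
    theorem asks for the derivative only off a finite set in the interior, and 0 stays below the
    speed.\<close>
  define f' where "f' = (\<lambda>t. if t \<in> {0<..<1} - S
    then - (c * (x \<bullet> v t)) / sqrt (1 - (c * (x \<bullet> \<gamma> t))\<^sup>2) else 0)"
  have "(f' has_integral (f 1 - f 0)) {0..1}"
  proof (rule fundamental_theorem_of_calculus_interior_strong[OF S(1)])
    fix t assume t: "t \<in> {0<..<1} - S"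
    have "((\<lambda>s. c * (x \<bullet> \<gamma> s)) has_real_derivative c * (x \<bullet> v t)) (at t)"
      using der[OF t] unfolding has_real_derivative_iff_has_vector_derivative has_vector_derivative_def
      by (auto intro!: derivative_eq_intros simp: algebra_simps)
    moreover have "(arccos has_real_derivative inverse (- sqrt (1 - (c * (x \<bullet> \<gamma> t))\<^sup>2))) (at (c * (x \<bullet> \<gamma> t)))"
      using bound[of t] t by (intro DERIV_arccos) auto
    ultimately have "((\<lambda>s. arccos (c * (x \<bullet> \<gamma> s))) has_real_derivative
        inverse (- sqrt (1 - (c * (x \<bullet> \<gamma> t))\<^sup>2)) * (c * (x \<bullet> v t))) (at t)"
      by (rule DERIV_chain2[rotated])
    then show "(f has_vector_derivative f' t) (at t)"
      using t unfolding has_real_derivative_iff_has_vector_derivative f_def f'_def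
      by (simp add: divide_inverse mult.commute)
  next
    show "continuous_on {0..1} f"
      unfolding f_def using bound
      by (intro continuous_on_arccos' continuous_intros cont) (force simp: abs_less_iff intro: less_imp_le)+
  qed auto
  moreover have "f' t \<le> norm (v t)" if "t \<in> {0..1}" for t
  proof (cases "t \<in> {0<..<1} - S")
    case True
    let ?s = "x \<bullet> \<gamma> t"
    have orth: "\<gamma> t \<bullet> v t = 0"
      by (rule sphere_velocity_orthogonal[OF der[OF True], of "{0<..<1}"]) (use True on_sphere in auto)
    have pos: "0 < 1 - (c * ?s)\<^sup>2"
      using bound[OF that] by (simp add: abs_square_less_1)
    have "(c * (x \<bullet> v t))\<^sup>2 \<le> c\<^sup>2 * ((1 - ?s\<^sup>2) * (norm (v t))\<^sup>2)"
      using inner_sphere_derivative_bound[OF assms(3) on_sphere[OF that] orth]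
      by (simp add: power_mult_distrib mult_left_mono)
    also have "\<dots> = (c\<^sup>2 - (c * ?s)\<^sup>2) * (norm (v t))\<^sup>2"
      by (simp add: algebra_simps)
    \<comment> \<open>The scaling only helps: since \<open>c < 1\<close>, the scaled angle moves no
      faster than the path.\<close>
    also have "\<dots> \<le> (1 - (c * ?s)\<^sup>2) * (norm (v t))\<^sup>2"
      using assms(4,5) by (intro mult_right_mono) (auto simp: power_le_one)
    also have "\<dots> = (sqrt (1 - (c * ?s)\<^sup>2) * norm (v t))\<^sup>2"
      using pos by (simp add: power_mult_distrib)
    finally have "\<bar>c * (x \<bullet> v t)\<bar> \<le> \<bar>sqrt (1 - (c * ?s)\<^sup>2) * norm (v t)\<bar>"
      by (simp only: abs_le_square_iff)
    then have "\<bar>c * (x \<bullet> v t)\<bar> \<le> sqrt (1 - (c * ?s)\<^sup>2) * norm (v t)"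
      using pos by simp
    then show ?thesis
      using True pos by (simp add: f'_def field_simps abs_le_iff)
  qed (auto simp: f'_def)
  ultimately show ?thesis
    using has_integral_le[OF _ L] by (simp add: f_def)
qed

text \<open>The scale tends to 1 from below. \<open>arccos\<close> is continuous on the closed
  interval, so the estimate survives in the limit, where the subtracted starting angle
  \<open>arccos (c * 1)\<close> vanishes.\<close>

lemma angle_le_length:
  fixes \<gamma> :: "real \<Rightarrow> 'a::euclidean_space"
  assumes "has_length \<gamma> L" "path_image \<gamma> \<subseteq> sphere 0 1"
  shows "arccos (pathstart \<gamma> \<bullet> pathfinish \<gamma>) \<le> L"
proof -
  let ?x = "pathstart \<gamma>" and ?y = "pathfinish \<gamma>"
  have unit: "norm ?x = 1" "norm ?y = 1"
    using assms(2) pathstart_in_path_image[of \<gamma>] pathfinish_in_path_image[of \<gamma>] by auto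
  then have bd: "\<bar>?x \<bullet> ?y\<bar> \<le> 1"
    using Cauchy_Schwarz_ineq2[of ?x ?y] by simp
  define h where "h = (\<lambda>c. arccos (c * (?x \<bullet> ?y)) - arccos (c * 1))"
  have "continuous_on {0..1} h"
  proof -
    have "\<bar>c * (?x \<bullet> ?y)\<bar> \<le> 1" if "c \<in> {0..1}" for c
      using that bd by (simp add: abs_mult mult_le_one)
    then show ?thesis
      unfolding h_def by (intro continuous_on_diff continuous_on_arccos' continuous_intros)
        (force simp: abs_le_iff)+
  qed
  then have "(h \<longlongrightarrow> h 1) (at_left 1)"
    by (simp add: continuous_on_Icc_at_leftD)
  moreover have "eventually (\<lambda>c. h c \<le> L) (at_left 1)"
    using eventually_at_left_real[of 0 "1::real"]
  proof (rule eventually_mono)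
    fix c :: real assume "c \<in> {0<..<1}"
    then show "h c \<le> L"
      using scaled_angle_le_length[OF assms unit(1), of c] unit(1)
      by (simp add: h_def pathstart_def pathfinish_def norm_eq_1)
  qed simp
  ultimately have "h 1 \<le> L"
    by (simp add: tendsto_upperbound)
  then show ?thesis
    by (simp add: h_def)
qed

text \<open>\<open>z\<close> is the direction in which a great circle leaves \<open>x\<close>
  towards \<open>y\<close>. If \<open>y\<close> is \<open>x\<close> or \<open>- x\<close>, every
  orthogonal direction serves, and dimension 2 guarantees that one exists.\<close>

lemma sphere_polar_form:
  fixes x y :: "'a::euclidean_space"
  assumes "2 \<le> DIM('a)" "norm x = 1" "norm y = 1"
  obtains z where "norm z = 1" "x \<bullet> z = 0"
    "y = cos (arccos (x \<bullet> y)) *\<^sub>R x + sin (arccos (x \<bullet> y)) *\<^sub>R z"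
proof -
  have bd: "\<bar>x \<bullet> y\<bar> \<le> 1"
    using Cauchy_Schwarz_ineq2[of x y] assms by simp
  let ?s = "sqrt (1 - (x \<bullet> y)\<^sup>2)" and ?h = "y - (x \<bullet> y) *\<^sub>R x"
  have cs: "cos (arccos (x \<bullet> y)) = x \<bullet> y" "sin (arccos (x \<bullet> y)) = ?s"
    using bd by (auto simp: cos_arccos_abs sin_arccos_abs)
  have n: "norm ?h = ?s"
    using assms unfolding norm_eq_sqrt_inner
    by (simp add: algebra_simps inner_commute power2_eq_square norm_eq_1)
  show ?thesis
  proof (cases "?s = 0")
    case True
    then have "y = (x \<bullet> y) *\<^sub>R x" using n by auto
    obtain w where w: "w \<noteq> 0" "orthogonal x w"
      using orthogonal_to_vector_exists assms(1) by blast
    show ?thesis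
    proof (rule that[of "w /\<^sub>R norm w"])
      show "y = cos (arccos (x \<bullet> y)) *\<^sub>R x + sin (arccos (x \<bullet> y)) *\<^sub>R (w /\<^sub>R norm w)"
        unfolding cs using True \<open>y = _\<close> by simp
    qed (use w in \<open>auto simp: orthogonal_def\<close>)
  next
    case False
    show ?thesis
    proof (rule that[of "?h /\<^sub>R ?s"])
      show "norm (?h /\<^sub>R ?s) = 1"
        using False n by (metis norm_ge_zero abs_of_nonneg norm_scaleR abs_inverse left_inverse)
      show "x \<bullet> (?h /\<^sub>R ?s) = 0"
        using assms by (simp add: inner_diff_right norm_eq_1)
      show "y = cos (arccos (x \<bullet> y)) *\<^sub>R x + sin (arccos (x \<bullet> y)) *\<^sub>R (?h /\<^sub>R ?s)"
        unfolding cs using False by simp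
    qed
  qed
qed

lemma great_circle_unit:
  fixes x z :: "'a::real_inner"
  assumes "norm x = 1" "norm z = 1" "x \<bullet> z = 0"
  shows "norm (cos t *\<^sub>R x + sin t *\<^sub>R z) = 1"
proof -
  have "(cos t *\<^sub>R x + sin t *\<^sub>R z) \<bullet> (cos t *\<^sub>R x + sin t *\<^sub>R z) = (cos t)\<^sup>2 + (sin t)\<^sup>2"
    using assms by (simp add: algebra_simps inner_commute power2_eq_square norm_eq_1)
  then show ?thesis by (simp add: norm_eq_1)
qed

lemma great_circle_has_length:
  fixes x z :: "'a::euclidean_space"
  assumes "norm x = 1" "norm z = 1" "x \<bullet> z = 0" "0 \<le> \<theta>"
  shows "has_length (\<lambda>t. cos (\<theta> * t) *\<^sub>R x + sin (\<theta> * t) *\<^sub>R z) \<theta>"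
proof -
  let ?g = "\<lambda>t. cos (\<theta> * t) *\<^sub>R x + sin (\<theta> * t) *\<^sub>R z"
  \<comment> \<open>The derivative is written as the same circle a quarter turn ahead, so that
    \<open>great_circle_unit\<close> also gives its norm.\<close>
  let ?d = "\<lambda>t. \<theta> *\<^sub>R (cos (\<theta> * t + pi / 2) *\<^sub>R x + sin (\<theta> * t + pi / 2) *\<^sub>R z)"
  have d: "(?g has_vector_derivative ?d t) (at t)" for t
    unfolding has_vector_derivative_def
    by (auto intro!: derivative_eq_intros ext simp: cos_add sin_add algebra_simps)
  have "?g C1_differentiable_on {0..1}"
    unfolding C1_differentiable_on_def
    by (rule exI[of _ ?d]) (use d in \<open>auto intro!: continuous_intros\<close>)
  then have "valid_path ?g"
    by (simp add: valid_path_def C1_differentiable_imp_piecewise)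
  moreover have "norm (vector_derivative ?g (at t within {0..1})) = \<theta>" if "t \<in> {0..1}" for t
  proof -
    have "vector_derivative ?g (at t within {0..1}) = ?d t"
      by (rule vector_derivative_at_within_ivl[OF d]) (use that in auto)
    then show ?thesis
      using great_circle_unit[OF assms(1-3)] assms(4) by simp
  qed
  moreover have "((\<lambda>_. \<theta>) has_integral \<theta>) {0..1::real}"
    using has_integral_const_real[of \<theta> 0 1] by simp
  moreover have "((\<lambda>t. norm (vector_derivative ?g (at t within {0..1}))) has_integral \<theta>) {0..1}"
    using calculation by (subst has_integral_cong) auto
  ultimately show ?thesis
    unfolding has_length_def by blast
qed

lemma geodesic_dist_sphere:
  fixes x y :: "'a::euclidean_space"
  assumes "2 \<le> DIM('a)" "norm x = 1" "norm y = 1"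
  shows "geodesic_dist (sphere 0 1) x y = arccos (x \<bullet> y)"
  unfolding geodesic_dist_def
proof (rule cInf_eq_minimum)
  obtain z where z: "norm z = 1" "x \<bullet> z = 0"
    "y = cos (arccos (x \<bullet> y)) *\<^sub>R x + sin (arccos (x \<bullet> y)) *\<^sub>R z"
    using sphere_polar_form[OF assms] .
  have "0 \<le> arccos (x \<bullet> y)"
    using Cauchy_Schwarz_ineq2[of x y] assms by (intro arccos_lbound) (auto simp: abs_le_iff)
  then show "arccos (x \<bullet> y) \<in> {L. \<exists>\<gamma>. has_length \<gamma> L \<and> path_image \<gamma> \<subseteq> sphere 0 1 \<and>
      pathstart \<gamma> = x \<and> pathfinish \<gamma> = y}"
    using great_circle_has_length[OF assms(2) z(1,2)] great_circle_unit[OF assms(2) z(1,2)] z(3)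
    by (auto simp: path_image_def pathstart_def pathfinish_def
        intro!: exI[of _ "\<lambda>t. cos (arccos (x \<bullet> y) * t) *\<^sub>R x + sin (arccos (x \<bullet> y) * t) *\<^sub>R z"])
next
  fix L assume "L \<in> {L. \<exists>\<gamma>. has_length \<gamma> L \<and> path_image \<gamma> \<subseteq> sphere 0 1 \<and>
      pathstart \<gamma> = x \<and> pathfinish \<gamma> = y}"
  then show "arccos (x \<bullet> y) \<le> L"
    using angle_le_length by fastforce
qed

section \<open>Rates of the separations\<close>

lemma sphere_tangent_curve:
  fixes x a :: "'a::real_inner"
  assumes "norm x = 1" "x \<bullet> a = 0"
  obtains g where "\<And>t::real. norm (g t) = 1" "g 0 = x" "(g has_vector_derivative a) (at 0)"
proof
  \<comment> \<open>For \<open>a = 0\<close> the division by zero makes this the constant curve.\<close>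
  let ?g = "\<lambda>t::real. cos (norm a * t) *\<^sub>R x + sin (norm a * t) *\<^sub>R (a /\<^sub>R norm a)"
  show "norm (?g t) = 1" for t
    using assms great_circle_unit[of x "a /\<^sub>R norm a"] by (cases "a = 0") auto
  show "?g 0 = x" by simp
  show "(?g has_vector_derivative a) (at 0)"
    unfolding has_vector_derivative_def
    by (cases "a = 0") (auto intro!: derivative_eq_intros)
qed

text \<open>The derivative within the spheres is determined on tangent pairs only. There it is
  computed along curves in the spheres, on which \<open>f\<close> coincides with an ambient function
  \<open>F\<close> whose derivative is known.\<close>

lemma frechet_derivative_within_spheres:
  fixes f F :: "'a::real_inner \<times> 'a \<Rightarrow> real"
  assumes "f differentiable (at (x, y) within sphere 0 1 \<times> sphere 0 1)"
    and "norm x = 1" "norm y = 1" "x \<bullet> a = 0" "y \<bullet> b = 0"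
    and "\<And>x y. norm x = 1 \<Longrightarrow> norm y = 1 \<Longrightarrow> f (x, y) = F (x, y)"
    and "(F has_derivative F') (at (x, y))"
  shows "frechet_derivative f (at (x, y) within sphere 0 1 \<times> sphere 0 1) (a, b) = F' (a, b)"
proof -
  let ?S = "sphere 0 1 \<times> sphere 0 1 :: ('a \<times> 'a) set"
  obtain g where g: "\<And>t::real. norm (g t) = 1" "g 0 = x" "(g has_vector_derivative a) (at 0)"
    using sphere_tangent_curve assms by blast
  obtain h where h: "\<And>t::real. norm (h t) = 1" "h 0 = y" "(h has_vector_derivative b) (at 0)"
    using sphere_tangent_curve assms by blast
  let ?c = "\<lambda>t. (g t, h t)"
  have c: "(?c has_derivative (\<lambda>t. t *\<^sub>R (a, b))) (at 0)"
    using has_derivative_Pair g(3) h(3) unfolding has_vector_derivative_def by fastforce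
  have "(f \<circ> ?c has_derivative frechet_derivative f (at (x, y) within ?S) \<circ> (\<lambda>t. t *\<^sub>R (a, b))) (at 0)"
  proof (rule diff_chain_within[where s = UNIV, OF c])
    have "?c ` UNIV \<subseteq> ?S" using g h by auto
    then show "(f has_derivative frechet_derivative f (at (x, y) within ?S)) (at (g 0, h 0) within range ?c)"
      using assms(1) has_derivative_subset unfolding frechet_derivative_works g(2) h(2) by blast
  qed
  moreover have "(F \<circ> ?c has_derivative F' \<circ> (\<lambda>t. t *\<^sub>R (a, b))) (at 0)"
    by (rule diff_chain_at[OF c]) (use assms(7) g h in simp)
  moreover have "f \<circ> ?c = F \<circ> ?c"
    using g h assms(6) by auto
  ultimately have "frechet_derivative f (at (x, y) within ?S) \<circ> (\<lambda>t. t *\<^sub>R (a, b)) = F' \<circ> (\<lambda>t. t *\<^sub>R (a, b))"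
    by (auto intro: has_derivative_unique)
  then have "(frechet_derivative f (at (x, y) within ?S) \<circ> (\<lambda>t. t *\<^sub>R (a, b))) 1 = (F' \<circ> (\<lambda>t. t *\<^sub>R (a, b))) 1"
    by simp
  then show ?thesis
    by simp
qed

lemma unit_inner_abs_less_1:
  fixes x y :: "'a::real_inner"
  assumes "norm x = 1" "norm y = 1" "x \<noteq> y" "x \<noteq> - y"
  shows "\<bar>x \<bullet> y\<bar> < 1"
proof -
  have "(x - y) \<bullet> (x - y) > 0" "(x + y) \<bullet> (x + y) > 0"
    using assms(3,4) by (auto simp: add_eq_0_iff2)
  then show ?thesis
    using assms(1,2) by (simp add: algebra_simps inner_commute norm_eq_1 abs_less_iff)
qed

lemma inner_prod_has_derivative:
  fixes x y :: "'a::real_inner"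
  shows "((\<lambda>z. fst z \<bullet> snd z) has_derivative (\<lambda>z. x \<bullet> snd z + fst z \<bullet> y)) (at (x, y))"
  by (auto intro!: derivative_eq_intros)

lemma arccos_inner_has_derivative:
  fixes x y :: "'a::real_inner"
  assumes "\<bar>x \<bullet> y\<bar> < 1"
  shows "((\<lambda>z. arccos (fst z \<bullet> snd z)) has_derivative
    (\<lambda>z. - (x \<bullet> snd z + fst z \<bullet> y) / sqrt (1 - (x \<bullet> y)\<^sup>2))) (at (x, y))"
proof -
  have "(arccos has_derivative (*) (inverse (- sqrt (1 - (x \<bullet> y)\<^sup>2)))) (at (fst (x, y) \<bullet> snd (x, y)))"
    using DERIV_arccos[of "x \<bullet> y"] assms by (simp add: has_field_derivative_def abs_less_iff)
  from diff_chain_at[OF inner_prod_has_derivative this] show ?thesis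
    by (simp add: o_def divide_inverse algebra_simps)
qed

lemma dist_has_derivative:
  fixes x y :: "'a::real_inner"
  assumes "x \<noteq> y"
  shows "((\<lambda>z. dist (fst z) (snd z)) has_derivative
    (\<lambda>z. (x - y) \<bullet> (fst z - snd z) / dist x y)) (at (x, y))"
proof -
  have "((\<lambda>z. fst z - snd z) has_derivative (\<lambda>z. fst z - snd z)) (at (x, y))"
    by (auto intro!: derivative_eq_intros)
  from diff_chain_at[OF this has_derivative_norm] show ?thesis
    using assms by (simp add: o_def dist_norm inner_commute sgn_div_norm divide_inverse mult.commute)
qed

lemma separation_differentiable:
  assumes "norm x = 1" "norm y = 1" "x \<noteq> y" "x \<noteq> - y"
  shows "separation c differentiable (at (x, y) within S2 \<times> S2)"
proof (cases c)
  case Blue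
  have "separation Blue = (\<lambda>z. dist (fst z) (snd z))" by auto
  then show ?thesis
    using has_derivative_at_withinI[OF dist_has_derivative[OF assms(3)]] Blue
    unfolding differentiable_def by auto
next
  case Red
  have "((\<lambda>z. arccos (fst z \<bullet> snd z)) has_derivative
    (\<lambda>z. - (x \<bullet> snd z + fst z \<bullet> y) / sqrt (1 - (x \<bullet> y)\<^sup>2))) (at (x, y) within S2 \<times> S2)"
    using arccos_inner_has_derivative unit_inner_abs_less_1[OF assms] has_derivative_at_withinI by blast
  then have "(separation Red has_derivative
    (\<lambda>z. - (x \<bullet> snd z + fst z \<bullet> y) / sqrt (1 - (x \<bullet> y)\<^sup>2))) (at (x, y) within S2 \<times> S2)"
    by (rule has_derivative_transform[rotated 2])
      (use assms in \<open>auto simp: geodesic_dist_sphere\<close>)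
  then show ?thesis
    using Red unfolding differentiable_def by blast
qed

lemma separation_derivative:
  assumes "norm x = 1" "norm y = 1" "x \<noteq> y" "x \<noteq> - y"
  obtains k where "k \<noteq> 0" "\<And>a b. x \<bullet> a = 0 \<Longrightarrow> y \<bullet> b = 0 \<Longrightarrow>
    frechet_derivative (separation c) (at (x, y) within S2 \<times> S2) (a, b) = k * (x \<bullet> b + y \<bullet> a)"
proof (cases c)
  case Blue
  show ?thesis
  proof (rule that[of "- 1 / dist x y"])
    fix a b assume ab: "x \<bullet> a = 0" "y \<bullet> b = 0"
    have "frechet_derivative (separation c) (at (x, y) within S2 \<times> S2) (a, b)
      = (x - y) \<bullet> (fst (a, b) - snd (a, b)) / dist x y"
      by (rule frechet_derivative_within_spheres[OF separation_differentiable[OF assms] assms(1,2) ab _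
            dist_has_derivative[OF assms(3)]]) (simp add: Blue)
    \<comment> \<open>Tangency deletes \<open>x \<bullet> a\<close> and \<open>y \<bullet> b\<close>
      from the expanded inner product and leaves the symmetric cross terms.\<close>
    then show "frechet_derivative (separation c) (at (x, y) within S2 \<times> S2) (a, b)
      = - 1 / dist x y * (x \<bullet> b + y \<bullet> a)"
      using ab by (simp add: inner_diff_left inner_diff_right diff_divide_distrib add_divide_distrib)
  qed (use assms in auto)
next
  case Red
  have lt: "\<bar>x \<bullet> y\<bar> < 1"
    using unit_inner_abs_less_1[OF assms] .
  show ?thesis
  proof (rule that[of "- 1 / sqrt (1 - (x \<bullet> y)\<^sup>2)"])
    have "(x \<bullet> y)\<^sup>2 < 1" using lt by (simp add: abs_square_less_1)
    then show "- 1 / sqrt (1 - (x \<bullet> y)\<^sup>2) \<noteq> 0" by simp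
    fix a b assume ab: "x \<bullet> a = 0" "y \<bullet> b = 0"
    have "frechet_derivative (separation c) (at (x, y) within S2 \<times> S2) (a, b)
      = - (x \<bullet> snd (a, b) + fst (a, b) \<bullet> y) / sqrt (1 - (x \<bullet> y)\<^sup>2)"
      by (rule frechet_derivative_within_spheres[OF separation_differentiable[OF assms] assms(1,2) ab _
            arccos_inner_has_derivative[OF lt]]) (simp add: Red geodesic_dist_sphere)
    then show "frechet_derivative (separation c) (at (x, y) within S2 \<times> S2) (a, b)
      = - 1 / sqrt (1 - (x \<bullet> y)\<^sup>2) * (x \<bullet> b + y \<bullet> a)"
      by (simp add: inner_commute add_divide_distrib diff_divide_distrib)
  qed
qed

text \<open>Along a great circle through the antipode the distance is
  \<open>pi - \<bar>t\<bar>\<close>, whose one-sided derivatives at 0 are 1 and -1.\<close>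

lemma not_differentiable_Red_antipodal:
  assumes "norm x = 1"
  shows "\<not> separation Red differentiable (at (x, - x) within S2 \<times> S2)"
proof
  assume "separation Red differentiable (at (x, - x) within S2 \<times> S2)"
  then obtain D where D: "(separation Red has_derivative D) (at (x, - x) within S2 \<times> S2)"
    unfolding differentiable_def by blast
  obtain w :: "real ^ 3" where "w \<noteq> 0" "orthogonal x w"
    using orthogonal_to_vector_exists[of x] by auto
  then have "norm (sgn w) = 1" "x \<bullet> sgn w = 0"
    by (auto simp: norm_sgn orthogonal_def sgn_div_norm)
  then obtain z where z: "norm z = 1" "x \<bullet> z = 0" by blast
  define g where "g = (\<lambda>t. (x, - (cos t *\<^sub>R x + sin t *\<^sub>R z)))"
  have unit: "norm (cos t *\<^sub>R x + sin t *\<^sub>R z) = 1" for t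
    using great_circle_unit assms z by blast
  have val: "separation Red (g t) = arccos (- cos t)" for t
    using unit[of t] assms z by (simp add: g_def geodesic_dist_sphere inner_right_distrib norm_eq_1
        flip: scaleR_minus_left scaleR_minus_right minus_add_distrib)
  have "(g has_derivative (\<lambda>t. (0, - (t *\<^sub>R z)))) (at 0)"
    unfolding g_def by (auto intro!: derivative_eq_intros)
  moreover have "(separation Red has_derivative D) (at (g 0) within range g)"
    by (rule has_derivative_subset[of _ _ _ "S2 \<times> S2"])
       (use D unit assms in \<open>auto simp: g_def norm_minus_cancel simp del: minus_add_distrib\<close>)
  ultimately have "((separation Red \<circ> g) has_derivative D \<circ> (\<lambda>t. (0, - (t *\<^sub>R z)))) (at 0)"
    by (rule diff_chain_within)
  then have "(separation Red \<circ> g) differentiable (at 0)"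
    unfolding differentiable_def by blast
  then obtain d where d: "(separation Red \<circ> g has_real_derivative d) (at 0)"
    using real_differentiable_def by blast
  have vals: "separation Red (g t) = pi - \<bar>t\<bar>" if "\<bar>t\<bar> \<le> pi" for t
    using that arccos_cos[of "pi - \<bar>t\<bar>"] by (simp add: val)
  have "(separation Red \<circ> g has_vector_derivative d) (at 0)"
    using d by (simp add: has_real_derivative_iff_has_vector_derivative)
  then have d': "(separation Red \<circ> g has_vector_derivative d) (at 0 within S)" for S
    by (rule has_vector_derivative_at_within)
  have "((\<lambda>t. pi - t) has_vector_derivative d) (at 0 within {0..pi})"
    by (rule has_vector_derivative_transform[OF _ _ d']) (use vals in auto)
  moreover have "((\<lambda>t. pi - t) has_vector_derivative -1) (at 0 within {0..pi})"
    by (auto simp: has_vector_derivative_def intro!: derivative_eq_intros)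
  ultimately have "d = -1"
    using vector_derivative_within_closed_interval[of 0 pi 0 "\<lambda>t. pi - t"] by auto
  have "((\<lambda>t. pi + t) has_vector_derivative d) (at 0 within {-pi..0})"
    by (rule has_vector_derivative_transform[OF _ _ d']) (use vals in auto)
  moreover have "((\<lambda>t. pi + t) has_vector_derivative 1) (at 0 within {-pi..0})"
    by (auto simp: has_vector_derivative_def intro!: derivative_eq_intros)
  ultimately have "d = 1"
    using vector_derivative_within_closed_interval[of "-pi" 0 0 "\<lambda>t. pi + t"] by auto
  with \<open>d = -1\<close> show False by simp
qed

text \<open>The first-order change of \<open>p v \<bullet> p w\<close>. It is symmetric, so the
  order chosen by \<open>ends\<close> does not matter, and it takes no colour.\<close>

definition pair_rate :: "('v \<Rightarrow> real ^ 3) \<Rightarrow> ('v \<Rightarrow> real ^ 3) \<Rightarrow> 'v set \<Rightarrow> real" where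
  "pair_rate p u e = (case ends e of (v, w) \<Rightarrow> p v \<bullet> u w + p w \<bullet> u v)"

lemma ends_cases:
  obtains "ends {v, w} = (v, w)" | "ends {v, w} = (w, v)"
proof -
  have "case ends {v, w} of (v', w') \<Rightarrow> {v, w} = {v', w'}"
    unfolding ends_def by (rule someI[of _ "(v, w)"]) simp
  then show thesis
    using that by (auto simp: doubleton_eq_iff split: prod.splits)
qed

lemma pair_rate_pair [simp]: "pair_rate p u {v, w} = p v \<bullet> u w + p w \<bullet> u v"
  by (cases rule: ends_cases[of v w]) (auto simp: pair_rate_def)

lemma pair_rate_loop [simp]: "pair_rate p u {v} = 2 * (p v \<bullet> u v)"
  using pair_rate_pair[of p u v v] by simp

lemma separation_rate_eq_pair_rate:
  assumes "norm (p v) = 1" "norm (p w) = 1" "v \<noteq> w \<Longrightarrow> p v \<noteq> p w \<and> p v \<noteq> - p w"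
  shows "\<exists>k. k \<noteq> 0 \<and> (\<forall>u. p v \<bullet> u v = 0 \<and> p w \<bullet> u w = 0 \<longrightarrow>
    separation_rate p u (c, {v, w}) = k * pair_rate p u {v, w})"
proof (cases "v = w")
  case True
  then have "ends {v, w} = (v, v)"
    by (cases rule: ends_cases[of v w]) auto
  then show ?thesis
    \<comment> \<open>A loop has rate 0, and its pair rate \<open>2 * (p v \<bullet> u v)\<close>
      vanishes by tangency, so any nonzero factor works.\<close>
    using True by (intro exI[of _ 1]) auto
next
  case False
  then have *: "p v \<noteq> p w" "p v \<noteq> - p w" "p w \<noteq> p v" "p w \<noteq> - p v"
    using assms(3) by (auto simp: minus_equation_iff)
  show ?thesis
  proof (cases rule: ends_cases[of v w])
    case 1
    obtain k where "k \<noteq> 0" "\<And>a b. p v \<bullet> a = 0 \<Longrightarrow> p w \<bullet> b = 0 \<Longrightarrow>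
      frechet_derivative (separation c) (at (p v, p w) within S2 \<times> S2) (a, b) = k * (p v \<bullet> b + p w \<bullet> a)"
      using separation_derivative[OF assms(1,2) *(1,2)] by blast
    then show ?thesis
      using 1 False by (intro exI[of _ k]) simp
  next
    case 2
    obtain k where "k \<noteq> 0" "\<And>a b. p w \<bullet> a = 0 \<Longrightarrow> p v \<bullet> b = 0 \<Longrightarrow>
      frechet_derivative (separation c) (at (p w, p v) within S2 \<times> S2) (a, b) = k * (p w \<bullet> b + p v \<bullet> a)"
      using separation_derivative[OF assms(2,1) *(3,4)] by blast
    then show ?thesis
      using 2 False by (intro exI[of _ k]) (simp add: add.commute)
  qed
qed

section \<open>Independent families of functionals\<close>

text \<open>A functional vanishing on a common kernel is a combination of the functionals defining
  it. Closure under \<open>u + k w\<close> is all that is asked of \<open>T\<close>, which covers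
  tangent fields as well as all fields.\<close>

lemma functional_in_span_if_kernel:
  fixes r :: "'i \<Rightarrow> ('v \<Rightarrow> 'a::real_vector) \<Rightarrow> real"
  assumes "finite I"
    and closed: "\<And>u w k. u \<in> T \<Longrightarrow> w \<in> T \<Longrightarrow> (\<lambda>x. u x + k *\<^sub>R w x) \<in> T"
    and "\<And>i u w k. i \<in> I \<Longrightarrow> r i (\<lambda>x. u x + k *\<^sub>R w x) = r i u + k * r i w"
    and "\<And>u w k. f (\<lambda>x. u x + k *\<^sub>R w x) = f u + k * f w"
    and "\<And>u. u \<in> T \<Longrightarrow> (\<And>i. i \<in> I \<Longrightarrow> r i u = 0) \<Longrightarrow> f u = 0"
  shows "\<exists>c. \<forall>u\<in>T. f u = (\<Sum>i\<in>I. c i * r i u)"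
  using assms(1,3-)
proof (induction I arbitrary: f)
  case empty
  then show ?case by simp
next
  case (insert j I)
  have upd: "(\<Sum>i\<in>insert j I. (c(j := m)) i * r i u) = m * r j u + (\<Sum>i\<in>I. c i * r i u)" for c m u
  proof -
    have "(\<Sum>i\<in>I. (c(j := m)) i * r i u) = (\<Sum>i\<in>I. c i * r i u)"
      using insert.hyps by (intro sum.cong) auto
    then show ?thesis using insert.hyps by simp
  qed
  show ?case
  proof (cases "\<exists>u0\<in>T. (\<forall>i\<in>I. r i u0 = 0) \<and> r j u0 \<noteq> 0")
    case True
    then obtain u0 where u0: "u0 \<in> T" "\<And>i. i \<in> I \<Longrightarrow> r i u0 = 0" "r j u0 \<noteq> 0" by blast
    \<comment> \<open>The only possible coefficient of \<open>r j\<close>, read off at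
      \<open>u0\<close>. Correcting a vector by a multiple of \<open>u0\<close> moves it from the
      kernel of \<open>I\<close> into that of \<open>insert j I\<close>.\<close>
    define m where "m = f u0 / r j u0"
    have "\<exists>c. \<forall>u\<in>T. f u - m * r j u = (\<Sum>i\<in>I. c i * r i u)"
    proof (rule insert.IH)
      fix u assume u: "u \<in> T" "\<And>i. i \<in> I \<Longrightarrow> r i u = 0"
      let ?w = "\<lambda>x. u x + (- (r j u / r j u0)) *\<^sub>R u0 x"
      have "f ?w = 0"
      proof (rule insert.prems(3))
        show "?w \<in> T" using closed u u0 by blast
        show "r i ?w = 0" if "i \<in> insert j I" for i
          using that u u0 insert.prems(1)[of i u "- (r j u / r j u0)" u0] by auto
      qed
      then show "f u - m * r j u = 0"
        using insert.prems(2)[of u "- (r j u / r j u0)" u0] by (simp add: m_def field_simps)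
    qed (use insert.prems in \<open>auto simp: algebra_simps\<close>)
    then obtain c where "\<forall>u\<in>T. f u - m * r j u = (\<Sum>i\<in>I. c i * r i u)" ..
    then show ?thesis
      using upd[of c m] by (intro exI[of _ "c(j := m)"]) (auto simp: algebra_simps)
  next
    case False
    \<comment> \<open>Here \<open>r j\<close> already vanishes on the kernel of \<open>I\<close>, so
      it receives coefficient 0.\<close>
    have "\<exists>c. \<forall>u\<in>T. f u = (\<Sum>i\<in>I. c i * r i u)"
      by (rule insert.IH) (use insert.prems False in \<open>blast+\<close>)
    then obtain c where "\<forall>u\<in>T. f u = (\<Sum>i\<in>I. c i * r i u)" ..
    then show ?thesis
      using upd[of c 0] by (intro exI[of _ "c(j := 0)"]) auto
  qed
qed

lemma sum_fun_apply: "(\<Sum>i\<in>I. f i) x = (\<Sum>i\<in>I. f i x)"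
  by (induction I rule: infinite_finite_induct) auto

text \<open>Stated for indexed families rather than sets: a blue and a red edge with the same ends
  give the same functional and must count as dependent.\<close>

definition independent_on :: "'x set \<Rightarrow> 'i set \<Rightarrow> ('i \<Rightarrow> 'x \<Rightarrow> real) \<Rightarrow> bool" where
  "independent_on T I r \<longleftrightarrow> (\<forall>s. (\<forall>u\<in>T. (\<Sum>i\<in>I. s i * r i u) = 0) \<longrightarrow> (\<forall>i\<in>I. s i = 0))"

lemma independent_onD:
  assumes "independent_on T I r" "\<And>u. u \<in> T \<Longrightarrow> (\<Sum>i\<in>I. s i * r i u) = 0" "i \<in> I"
  shows "s i = 0"
  using assms unfolding independent_on_def by blast

text \<open>Passing to sets forgets multiplicities, so injectivity comes first: two equal members
  would satisfy the relation with coefficients 1 and -1.\<close>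

lemma independent_family:
  fixes r :: "'i \<Rightarrow> 'e \<Rightarrow> real"
  assumes "finite I" "independent_on UNIV I r"
  shows "inj_on r I" "fun_space.independent (r ` I)"
proof -
  show inj: "inj_on r I"
  proof (rule inj_onI, rule ccontr)
    fix i j assume ij: "i \<in> I" "j \<in> I" "r i = r j" "i \<noteq> j"
    have "(\<Sum>k\<in>I. (if k = i then 1 else if k = j then -1 else 0) * r k u) = 0" for u
    proof -
      have "(\<Sum>k\<in>I. (if k = i then 1 else if k = j then -1 else 0) * r k u)
        = (\<Sum>k\<in>I. (if k = i then r i u else 0) - (if k = j then r j u else 0))"
        using ij by (intro sum.cong) auto
      also have "\<dots> = r i u - r j u"
        using ij assms(1) by (simp add: sum_subtractf)
      finally show ?thesis using ij by simp
    qed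
    then show False
      using independent_onD[OF assms(2), of "\<lambda>k. if k = i then 1 else if k = j then -1 else 0" i] ij
      by simp
  qed
  show "fun_space.independent (r ` I)"
  proof (rule fun_space.independent_if_scalars_zero)
    fix f x assume "(\<Sum>x\<in>r ` I. (\<lambda>e. f x * x e)) = 0" and x: "x \<in> r ` I"
    then have "(\<Sum>i\<in>I. f (r i) * r i u) = 0" for u
      by (simp add: sum.reindex[OF inj] fun_eq_iff sum_fun_apply)
    then have "f (r i) = 0" if "i \<in> I" for i
      using independent_onD[OF assms(2), of "\<lambda>i. f (r i)"] that by simp
    with x show "f x = 0" by blast
  qed (use assms in simp)
qed

lemma family_in_span:
  fixes C :: "'j \<Rightarrow> 'e \<Rightarrow> real"
  assumes "\<And>u. r u = (\<Sum>j\<in>J. a j * C j u)"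
  shows "r \<in> fun_space.span (C ` J)"
proof -
  have "r = (\<Sum>j\<in>J. (\<lambda>u. a j * C j u))"
    by (rule ext) (simp add: assms sum_fun_apply)
  also have "\<dots> \<in> fun_space.span (C ` J)"
    by (intro fun_space.span_sum fun_space.span_scale fun_space.span_base) auto
  finally show ?thesis .
qed

lemma independent_family_card_le:
  fixes r :: "'i \<Rightarrow> 'e \<Rightarrow> real" and C :: "'j \<Rightarrow> 'e \<Rightarrow> real"
  assumes "finite I" "finite J"
    and "independent_on UNIV I r"
    and "\<And>i. i \<in> I \<Longrightarrow> \<exists>a. \<forall>u. r i u = (\<Sum>j\<in>J. a j * C j u)"
  shows "card I \<le> card J"
proof -
  have "r ` I \<subseteq> fun_space.span (C ` J)"
  proof (rule image_subsetI)
    fix i assume "i \<in> I"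
    then obtain a where "\<forall>u. r i u = (\<Sum>j\<in>J. a j * C j u)"
      using assms(4) by blast
    then show "r i \<in> fun_space.span (C ` J)"
      by (intro family_in_span) simp
  qed
  then have "card (r ` I) \<le> card (C ` J)"
    using fun_space.independent_span_bound[OF finite_imageI[OF assms(2)] independent_family(2)[OF assms(1,3)]]
    by simp
  then show ?thesis
    using card_image[OF independent_family(1)[OF assms(1,3)]] card_image_le[OF assms(2), of C] by simp
qed

text \<open>With equal cardinalities the independent family is a basis of the span of
  \<open>C\<close>, since one more independent member would exceed \<open>card J\<close>. So each
  \<open>C j\<close> is a combination of the \<open>r i\<close>.\<close>

lemma independent_family_spans:
  fixes r :: "'i \<Rightarrow> 'e \<Rightarrow> real" and C :: "'j \<Rightarrow> 'e \<Rightarrow> real"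
  assumes "finite I" "finite J"
    and "independent_on UNIV I r"
    and "\<And>i. i \<in> I \<Longrightarrow> \<exists>a. \<forall>u. r i u = (\<Sum>j\<in>J. a j * C j u)"
    and "card I = card J" "j \<in> J" "\<And>i. i \<in> I \<Longrightarrow> r i u = 0"
  shows "C j u = 0"
proof -
  have sub: "r ` I \<subseteq> fun_space.span (C ` J)"
  proof (rule image_subsetI)
    fix i assume "i \<in> I"
    then obtain a where "\<forall>u. r i u = (\<Sum>j\<in>J. a j * C j u)"
      using assms(4) by blast
    then show "r i \<in> fun_space.span (C ` J)"
      by (intro family_in_span) simp
  qed
  have ind: "fun_space.independent (r ` I)" and card: "card (r ` I) = card I"
    using independent_family[OF assms(1,3)] by (auto simp: card_image)
  have "C j \<in> fun_space.span (r ` I)"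
  proof (rule ccontr)
    assume notin: "C j \<notin> fun_space.span (r ` I)"
    then have ins: "fun_space.independent (insert (C j) (r ` I))"
      using ind by (rule fun_space.independent_insertI)
    have "insert (C j) (r ` I) \<subseteq> fun_space.span (C ` J)"
      using sub assms(6) by (auto intro: fun_space.span_base)
    from fun_space.independent_span_bound[OF finite_imageI[OF assms(2)] ins this]
    have "card (insert (C j) (r ` I)) \<le> card (C ` J)" ..
    moreover have "C j \<notin> r ` I"
      using notin fun_space.span_base by blast
    ultimately show False
      using card card_image_le[OF assms(2), of C] assms(1,5) by simp
  qed
  then obtain b where "C j = (\<Sum>x\<in>r ` I. (\<lambda>u. b x * x u))"
    using assms(1) by (auto simp: fun_space.span_finite)
  then have "C j u = (\<Sum>x\<in>r ` I. b x * x u)"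
    by (simp add: sum_fun_apply)
  also have "\<dots> = 0"
    using assms(7) by (intro sum.neutral) auto
  finally show ?thesis .
qed

section \<open>Rank and stresses\<close>

lemma pair_rate_linear: "pair_rate p (\<lambda>x. u x + k *\<^sub>R w x) e = pair_rate p u e + k * pair_rate p w e"
  by (simp add: pair_rate_def inner_add_right algebra_simps split: prod.split)

lemma tangent_fields_closed:
  "u \<in> tangent_fields V p \<Longrightarrow> w \<in> tangent_fields V p \<Longrightarrow> (\<lambda>x. u x + k *\<^sub>R w x) \<in> tangent_fields V p"
  by (simp add: tangent_fields_def inner_add_right)

text \<open>Row independence of the rigidity matrix after dividing each row by its nonzero factor: 0
  is the only equilibrium stress.\<close>

abbreviation stress_free :: "'v set \<Rightarrow> 'v edge set \<Rightarrow> ('v \<Rightarrow> real ^ 3) \<Rightarrow> bool" where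
  "stress_free V E p \<equiv> independent_on (tangent_fields V p) E (\<lambda>e u. pair_rate p u (snd e))"

text \<open>Without such a motion, the row of \<open>e\<close> would vanish on the kernel of the
  other rows and be a combination of them, which is a stress with coefficient -1 at
  \<open>e\<close>.\<close>

lemma stress_free_dual_field:
  assumes "finite E" "stress_free V E p" "e \<in> E"
  shows "\<exists>u\<in>tangent_fields V p. (\<forall>e'\<in>E - {e}. pair_rate p u (snd e') = 0) \<and> pair_rate p u (snd e) \<noteq> 0"
proof (rule ccontr)
  assume no_dual: "\<not> ?thesis"
  have no: "pair_rate p u (snd e) = 0" if "u \<in> tangent_fields V p"
    "\<And>e'. e' \<in> E - {e} \<Longrightarrow> pair_rate p u (snd e') = 0" for u
    using that no_dual by blast
  have "\<exists>c. \<forall>u\<in>tangent_fields V p. pair_rate p u (snd e) = (\<Sum>e'\<in>E - {e}. c e' * pair_rate p u (snd e'))"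
    by (rule functional_in_span_if_kernel)
       (use assms(1) tangent_fields_closed pair_rate_linear no in auto)
  then obtain c where c: "\<forall>u\<in>tangent_fields V p.
    pair_rate p u (snd e) = (\<Sum>e'\<in>E - {e}. c e' * pair_rate p u (snd e'))" ..
  have "(c(e := -1)) e = 0"
  proof (rule independent_onD[OF assms(2) _ assms(3), where s = "c(e := -1)"])
    fix u assume "u \<in> tangent_fields V p"
    moreover have "(\<Sum>e'\<in>E - {e}. (c(e := -1)) e' * pair_rate p u (snd e'))
      = (\<Sum>e'\<in>E - {e}. c e' * pair_rate p u (snd e'))"
      by (rule sum.cong) auto
    ultimately show "(\<Sum>e'\<in>E. (c(e := -1)) e' * pair_rate p u (snd e')) = 0"
      using c assms(1,3) by (simp add: sum.remove)
  qed
  then show False by simp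
qed

lemma complete_edgesE:
  assumes "e \<in> complete_edges V"
  obtains c v w where "e = (c, {v, w})" "v \<in> V" "w \<in> V"
  using assms unfolding complete_edges_def by auto

lemma complete_edgesI: "v \<in> V \<Longrightarrow> w \<in> V \<Longrightarrow> (c, {v, w}) \<in> complete_edges V"
  unfolding complete_edges_def mem_Collect_eq
  by (rule exI[of _ c], rule exI[of _ v], rule exI[of _ w]) simp

lemma complete_edges_mono: "W \<subseteq> V \<Longrightarrow> complete_edges W \<subseteq> complete_edges V"
  by (auto elim!: complete_edgesE intro!: complete_edgesI)

lemma complete_edges_ends: "e \<in> complete_edges V \<Longrightarrow> snd e \<subseteq> V"
  by (auto elim!: complete_edgesE)

lemma complete_edges_restrict: "e \<in> complete_edges V \<Longrightarrow> snd e \<subseteq> X \<Longrightarrow> e \<in> complete_edges X"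
  by (auto elim!: complete_edgesE intro!: complete_edgesI)

lemma bicoloured_graph_finite: "bicoloured_graph V E \<Longrightarrow> finite V \<and> finite E"
proof -
  assume g: "bicoloured_graph V E"
  have "complete_edges V \<subseteq> UNIV \<times> Pow V" by (auto simp: complete_edges_def)
  moreover have "(UNIV :: colour set) = {Blue, Red}" by (auto intro: colour.exhaust)
  ultimately show ?thesis
    using g unfolding bicoloured_graph_def
    by (metis finite.emptyI finite.insertI finite_Pow_iff finite_SigmaI finite_subset)
qed

text \<open>Stronger than \<open>framework\<close>, which tolerates blue edges with antipodal ends:
  the nonzero factors between both kinds of rates are available only without such pairs.\<close>

definition generic :: "'v set \<Rightarrow> 'v edge set \<Rightarrow> ('v \<Rightarrow> real ^ 3) \<Rightarrow> bool" where
  "generic V E p \<longleftrightarrow> bicoloured_graph V E \<and> p ` V \<subseteq> S2 \<and>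
    (\<forall>c v w. (c, {v, w}) \<in> E \<and> v \<noteq> w \<longrightarrow> p v \<noteq> p w \<and> p v \<noteq> - p w)"

lemma generic_finite: "generic V E p \<Longrightarrow> finite V \<and> finite E"
  using bicoloured_graph_finite[of V E] by (simp add: generic_def)

lemma generic_framework:
  assumes "generic V E p" shows "framework V E p"
proof -
  have "p v \<in> S2" "p w \<in> S2" if "(c, {v, w}) \<in> E" for c v w
  proof -
    have "v \<in> V \<and> w \<in> V"
      using that assms by (auto simp: generic_def bicoloured_graph_def complete_edges_def doubleton_eq_iff)
    then show "p v \<in> S2" "p w \<in> S2" using assms by (auto simp: generic_def)
  qed
  then show ?thesis
    using assms separation_differentiable unfolding generic_def framework_def by auto
qed

lemma generic_separation_rate:
  assumes "generic V E p"
  shows "\<exists>k. \<forall>e\<in>E. k e \<noteq> 0 \<and>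
    (\<forall>u\<in>tangent_fields V p. separation_rate p u e = k e * pair_rate p u (snd e))"
proof (rule bchoice, rule ballI)
  fix e assume "e \<in> E"
  then have "e \<in> complete_edges V"
    using assms by (auto simp: generic_def bicoloured_graph_def)
  then obtain c v w where e: "e = (c, {v, w})" "v \<in> V" "w \<in> V"
    by (rule complete_edgesE)
  have "norm (p v) = 1" "norm (p w) = 1"
    using assms e by (auto simp: generic_def image_subset_iff)
  moreover have "v \<noteq> w \<Longrightarrow> p v \<noteq> p w \<and> p v \<noteq> - p w"
    using assms e \<open>e \<in> E\<close> unfolding generic_def by blast
  ultimately obtain k where "k \<noteq> 0" "\<forall>u. p v \<bullet> u v = 0 \<and> p w \<bullet> u w = 0 \<longrightarrow>
      separation_rate p u (c, {v, w}) = k * pair_rate p u {v, w}"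
    using separation_rate_eq_pair_rate[of p v w c] by blast
  then show "\<exists>k. k \<noteq> 0 \<and> (\<forall>u\<in>tangent_fields V p. separation_rate p u e = k * pair_rate p u (snd e))"
    using e by (intro exI[of _ k]) (auto simp: tangent_fields_def)
qed

text \<open>Rescaled dual fields are mapped to the unit vectors indexed by \<open>E\<close>, so the
  rigidity map is onto the functions supported on \<open>E\<close>.\<close>

lemma stress_free_imp_rank:
  assumes "generic V E p" "stress_free V E p"
  shows "rigidity_rank V E p = card E"
  unfolding rigidity_rank_def
proof (rule fun_space.dim_unique)
  note fin = generic_finite[OF assms(1), THEN conjunct2]
  obtain k where k_all: "\<forall>e\<in>E. k e \<noteq> 0 \<and>
      (\<forall>u\<in>tangent_fields V p. separation_rate p u e = k e * pair_rate p u (snd e))"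
    using generic_separation_rate[OF assms(1)] ..
  then have k: "\<And>e. e \<in> E \<Longrightarrow> k e \<noteq> 0"
    "\<And>e u. e \<in> E \<Longrightarrow> u \<in> tangent_fields V p \<Longrightarrow> separation_rate p u e = k e * pair_rate p u (snd e)"
    by auto
  let ?d = "\<lambda>e e'. if e' = e then 1 else 0 :: real"
  show "?d ` E \<subseteq> rigidity_map E p ` tangent_fields V p"
  proof
    fix f assume "f \<in> ?d ` E"
    then obtain e where e: "e \<in> E" "f = ?d e" by blast
    obtain u where u: "u \<in> tangent_fields V p" "\<And>e'. e' \<in> E - {e} \<Longrightarrow> pair_rate p u (snd e') = 0"
      "pair_rate p u (snd e) \<noteq> 0"
      using stress_free_dual_field[OF fin assms(2) e(1)] by blast
    define m where "m = 1 / (k e * pair_rate p u (snd e))"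
    define w where "w = (\<lambda>x. 0 + m *\<^sub>R u x)"
    have zero: "(\<lambda>_. 0) \<in> tangent_fields V p" by (simp add: tangent_fields_def)
    have w: "w \<in> tangent_fields V p"
      unfolding w_def using tangent_fields_closed[OF zero u(1)] .
    have pr: "pair_rate p w e' = m * pair_rate p u e'" for e'
      unfolding w_def using pair_rate_linear[of p "\<lambda>_. 0" m u e'] by (simp add: pair_rate_def split: prod.splits)
    have "rigidity_map E p w e' = f e'" for e'
    proof (cases "e' \<in> E")
      case True
      then have "rigidity_map E p w e' = k e' * (m * pair_rate p u (snd e'))"
        by (simp add: rigidity_map_def k(2)[OF _ w] pr)
      then show ?thesis
        using True u(2,3) k(1)[OF e(1)] e(2) by (cases "e' = e") (simp_all add: m_def)
    qed (use e in \<open>auto simp: rigidity_map_def\<close>)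
    then have "rigidity_map E p w = f" by blast
    then show "f \<in> rigidity_map E p ` tangent_fields V p" using w by blast
  qed
  show "rigidity_map E p ` tangent_fields V p \<subseteq> fun_space.span (?d ` E)"
  proof clarify
    fix u
    have "rigidity_map E p u x = (\<Sum>e\<in>E. rigidity_map E p u e * ?d e x)" for x
      using fin by (auto simp: rigidity_map_def if_distrib sum.delta' cong: if_cong)
    then show "rigidity_map E p u \<in> fun_space.span (?d ` E)"
      by (rule family_in_span)
  qed
  have "s e = 0" if "\<forall>x. (\<Sum>e\<in>E. s e * ?d e x) = 0" "e \<in> E" for s e
    using that(1)[rule_format, of e] that(2) fin by (simp add: if_distrib cong: if_cong)
  then have ind: "independent_on UNIV E ?d"
    by (simp add: independent_on_def)
  show "fun_space.independent (?d ` E)"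
    by (rule independent_family(2)[OF fin ind])
  show "card (?d ` E) = card E"
    by (rule card_image[OF independent_family(1)[OF fin ind]])
qed

lemma rank_imp_stress_free:
  assumes "generic V E p" "card E \<le> rigidity_rank V E p"
  shows "stress_free V E p"
  unfolding independent_on_def
proof (intro allI impI ballI, rule ccontr)
  note fin = generic_finite[OF assms(1), THEN conjunct2]
  obtain k where k_all: "\<forall>e\<in>E. k e \<noteq> 0 \<and>
      (\<forall>u\<in>tangent_fields V p. separation_rate p u e = k e * pair_rate p u (snd e))"
    using generic_separation_rate[OF assms(1)] ..
  then have k: "\<And>e. e \<in> E \<Longrightarrow> k e \<noteq> 0"
    "\<And>e u. e \<in> E \<Longrightarrow> u \<in> tangent_fields V p \<Longrightarrow> separation_rate p u e = k e * pair_rate p u (snd e)"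
    by auto
  fix s e0 assume s: "\<forall>u\<in>tangent_fields V p. (\<Sum>e\<in>E. s e * pair_rate p u (snd e)) = 0"
    and e0: "e0 \<in> E" "s e0 \<noteq> 0"
  \<comment> \<open>The stress determines the rate at \<open>e0\<close> from the other rates;
    \<open>k\<close> converts pair rates into separation rates. So \<open>card E - 1\<close> vectors
    span the image.\<close>
  let ?d = "\<lambda>e e'. if e' = e then 1 else if e' = e0 then - (s e / k e) * k e0 / s e0 else 0"
  have "rigidity_map E p ` tangent_fields V p \<subseteq> fun_space.span (?d ` (E - {e0}))"
  proof clarify
    fix u assume u: "u \<in> tangent_fields V p"
    have "rigidity_map E p u x = (\<Sum>e\<in>E - {e0}. rigidity_map E p u e * ?d e x)" for x
    proof (cases "x = e0")
      case True
      have "(\<Sum>e\<in>E - {e0}. rigidity_map E p u e * ?d e x)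
        = (\<Sum>e\<in>E - {e0}. - (k e0 / s e0) * (s e * pair_rate p u (snd e)))"
        using True k u by (intro sum.cong) (auto simp: rigidity_map_def)
      also have "\<dots> = - (k e0 / s e0) * (\<Sum>e\<in>E - {e0}. s e * pair_rate p u (snd e))"
        by (rule sum_distrib_left[symmetric])
      also have "(\<Sum>e\<in>E - {e0}. s e * pair_rate p u (snd e)) = - (s e0 * pair_rate p u (snd e0))"
        using s u fin e0(1) by (simp add: sum_diff1)
      finally show ?thesis
        using True e0 k u by (simp add: rigidity_map_def)
    next
      case False
      have "(\<Sum>e\<in>E - {e0}. rigidity_map E p u e * ?d e x)
        = (\<Sum>e\<in>E - {e0}. if e = x then rigidity_map E p u x else 0)"
        using False by (intro sum.cong) auto
      also have "\<dots> = rigidity_map E p u x"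
        using fin False by (auto simp: rigidity_map_def)
      finally show ?thesis by simp
    qed
    then show "rigidity_map E p u \<in> fun_space.span (?d ` (E - {e0}))"
      by (rule family_in_span)
  qed
  then have "rigidity_rank V E p \<le> card (?d ` (E - {e0}))"
    unfolding rigidity_rank_def by (rule fun_space.dim_le_card) (use fin in simp)
  also have "\<dots> \<le> card (E - {e0})"
    using fin by (intro card_image_le) simp
  also have "\<dots> < card E"
    using fin e0(1) by (intro psubset_card_mono) auto
  finally show False using assms(2) by simp
qed

text \<open>Regularity is applied to the complete graph on \<open>W\<close> instead of
  \<open>F\<close>: it has a red edge between any two vertices, and differentiability there rules
  out antipodal ends of blue edges too.\<close>

lemma completely_regular_generic:
  assumes "completely_regular V p" "subgraph W F V (complete_edges V)"
  shows "generic W F p"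
proof -
  have "subgraph W (complete_edges W) V (complete_edges V)"
    using assms(2) complete_edges_mono[of W V] by (simp add: subgraph_def bicoloured_graph_def)
  then have fw: "framework W (complete_edges W) p"
    using assms(1) by (simp add: completely_regular_def)
  have W: "bicoloured_graph W F" using assms(2) by (simp add: subgraph_def)
  have "p v \<noteq> p w \<and> p v \<noteq> - p w" if "v \<in> W" "w \<in> W" "v \<noteq> w" for v w
  proof -
    have "(Red, {w, v}) \<in> complete_edges W"
      using that by (intro complete_edgesI)
    then have "p w \<noteq> p v" "separation Red differentiable (at (p w, p v) within S2 \<times> S2)"
      using fw that unfolding framework_def by blast+
    moreover have "norm (p w) = 1"
      using fw that by (auto simp: framework_def)
    ultimately show ?thesis
      using not_differentiable_Red_antipodal[of "p w"] by auto
  qed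
  moreover have "v \<in> W \<and> w \<in> W" if "(c, {v, w}) \<in> F" for c v w
    using that W by (auto simp: bicoloured_graph_def complete_edges_def doubleton_eq_iff)
  ultimately have "\<forall>c v w. (c, {v, w}) \<in> F \<and> v \<noteq> w \<longrightarrow> p v \<noteq> p w \<and> p v \<noteq> - p w"
    by meson
  then show ?thesis
    using W fw by (simp add: generic_def framework_def)
qed

text \<open>The transfer principle: full row rank at one convenient placement \<open>q\<close>
  forces full row rank at \<open>p\<close>, whose rank is maximal.\<close>

lemma completely_regular_stress_free:
  assumes "completely_regular V p" "subgraph W F V (complete_edges V)"
    and "generic W F q" "stress_free W F q"
  shows "stress_free W F p"
proof (rule rank_imp_stress_free)
  show "generic W F p"
    using completely_regular_generic assms by blast
  have "rigidity_rank W F q \<le> rigidity_rank W F p"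
    using assms(1,2) generic_framework[OF assms(3)] unfolding completely_regular_def by blast
  then show "card F \<le> rigidity_rank W F p"
    using stress_free_imp_rank[OF assms(3,4)] by simp
qed

section \<open>Sparse graphs\<close>

definition induced_edges :: "'v edge set \<Rightarrow> 'v set \<Rightarrow> 'v edge set" where
  "induced_edges E X = {e \<in> E. snd e \<subseteq> X}"

lemma induced_edges_subset: "induced_edges E X \<subseteq> E"
  by (auto simp: induced_edges_def)

lemma sparse_induced_edges:
  assumes "bicoloured_graph V E" "sparse_2_3 V E" "X \<subseteq> V" "induced_edges E X \<noteq> {}"
  shows "card (induced_edges E X) + 3 \<le> 2 * card X"
proof -
  have "induced_edges E X \<subseteq> complete_edges X"
  proof
    fix e assume "e \<in> induced_edges E X"
    then have "e \<in> complete_edges V" "snd e \<subseteq> X"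
      using assms(1) by (auto simp: induced_edges_def bicoloured_graph_def)
    then show "e \<in> complete_edges X" by (rule complete_edges_restrict)
  qed
  then have "subgraph X (induced_edges E X) V E"
    using assms(1,3) induced_edges_subset[of E X] finite_subset[OF assms(3)]
    by (simp add: subgraph_def bicoloured_graph_def)
  moreover have "card (induced_edges E X) > 0"
    using assms(4) bicoloured_graph_finite[OF assms(1)] induced_edges_subset[of E X]
    by (meson card_gt_0_iff finite_subset)
  ultimately have "int (card (induced_edges E X)) \<le> 2 * int (card X) - 3"
    using assms(2) by (simp add: sparse_2_3_def)
  then show ?thesis by linarith
qed

lemma sparseI:
  assumes "bicoloured_graph V E"
    and "\<And>X. X \<subseteq> V \<Longrightarrow> induced_edges E X \<noteq> {} \<Longrightarrow> card (induced_edges E X) + 3 \<le> 2 * card X"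
  shows "sparse_2_3 V E"
  unfolding sparse_2_3_def
proof (intro allI impI, elim conjE)
  fix V' E' assume sub: "subgraph V' E' V E" and "0 < card E'"
  have "E' \<subseteq> induced_edges E V'"
    using sub complete_edges_ends[of _ V'] by (auto simp: subgraph_def bicoloured_graph_def induced_edges_def)
  moreover have "finite (induced_edges E V')"
    using bicoloured_graph_finite[OF assms(1)] induced_edges_subset finite_subset by blast
  ultimately have "card E' \<le> card (induced_edges E V')" "induced_edges E V' \<noteq> {}"
    using \<open>0 < card E'\<close> by (auto simp: card_mono)
  moreover have "V' \<subseteq> V" using sub by (simp add: subgraph_def)
  ultimately show "int (card E') \<le> 2 * int (card V') - 3"
    using assms(2)[of V'] by linarith
qed

lemma sparse_subgraph:
  assumes "sparse_2_3 V E" "subgraph V' E' V E"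
  shows "sparse_2_3 V' E'"
  unfolding sparse_2_3_def
proof (intro allI impI, elim conjE)
  fix V'' E'' assume "subgraph V'' E'' V' E'" "0 < card E''"
  moreover from this have "subgraph V'' E'' V E"
    using assms(2) by (auto simp: subgraph_def)
  ultimately show "int (card E'') \<le> 2 * int (card V'') - 3"
    using assms(1) by (simp add: sparse_2_3_def)
qed

text \<open>Edges inside both sets lie inside the intersection, while the union may gain edges
  between the two. This supermodularity drives the uncrossing of tight sets.\<close>

lemma card_induced_edges_Un:
  assumes "finite E"
  shows "card (induced_edges E X) + card (induced_edges E Y)
    \<le> card (induced_edges E (X \<union> Y)) + card (induced_edges E (X \<inter> Y))"
proof -
  have fin: "finite (induced_edges E A)" for A
    using assms induced_edges_subset finite_subset by blast
  have "card (induced_edges E X) + card (induced_edges E Y)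
    = card (induced_edges E X \<union> induced_edges E Y) + card (induced_edges E X \<inter> induced_edges E Y)"
    using card_Un_Int fin by blast
  also have "induced_edges E X \<inter> induced_edges E Y = induced_edges E (X \<inter> Y)"
    by (auto simp: induced_edges_def)
  also have "card (induced_edges E X \<union> induced_edges E Y) \<le> card (induced_edges E (X \<union> Y))"
    by (intro card_mono fin) (auto simp: induced_edges_def)
  finally show ?thesis by simp
qed

text \<open>If every edge between two of the neighbours is blocked by a tight set, then the tight
  sets have a tight union: either two of them share two vertices, or all three meet pairwise in a
  single vertex.\<close>

lemma no_three_blocking_sets:
  fixes V :: "'v set"
  assumes "bicoloured_graph V E" "sparse_2_3 V E" "X \<subseteq> V" "Y \<subseteq> V" "Z \<subseteq> V"
    and "a \<in> X" "b \<in> X" "b \<in> Y" "c \<in> Y" "a \<in> Z" "c \<in> Z" "distinct [a, b, c]"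
    and "2 * card X \<le> card (induced_edges E X) + 3"
    and "2 * card Y \<le> card (induced_edges E Y) + 3"
    and "2 * card Z \<le> card (induced_edges E Z) + 3"
    and room: "\<And>U. U \<subseteq> V \<Longrightarrow> {a, b, c} \<subseteq> U \<Longrightarrow> card (induced_edges E U) + 4 \<le> 2 * card U"
  shows False
proof -
  have fin: "finite X" "finite Y" "finite Z" "finite E"
    using assms(1-5) bicoloured_graph_finite finite_subset by blast+
  have small: "induced_edges E A = {}" if "A \<subseteq> V" "card A \<le> 1" for A
    using sparse_induced_edges[OF assms(1,2) that(1)] that(2) by linarith
  have meet: "card (A \<inter> B) = 1"
    if "A \<subseteq> V" "B \<subseteq> V" "A \<inter> B \<noteq> {}" "{a, b, c} \<subseteq> A \<union> B"
      "2 * card A \<le> card (induced_edges E A) + 3" "2 * card B \<le> card (induced_edges E B) + 3"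
    for A B
  proof (rule ccontr)
    have "finite A" "finite B"
      using that(1,2) bicoloured_graph_finite[OF assms(1)] finite_subset by blast+
    moreover assume "card (A \<inter> B) \<noteq> 1"
    ultimately have "2 \<le> card (A \<inter> B)"
      using that(3) by (metis One_nat_def Suc_1 Suc_leI card_gt_0_iff finite_Int le_neq_implies_less)
    \<comment> \<open>With two vertices the bound also holds if no edge is induced, as
      \<open>0 + 3 \<le> 2 * 2\<close>.\<close>
    then have "card (induced_edges E (A \<inter> B)) + 3 \<le> 2 * card (A \<inter> B)"
      using sparse_induced_edges[OF assms(1,2), of "A \<inter> B"] that(1) by (cases "induced_edges E (A \<inter> B) = {}") auto
    moreover have "card (induced_edges E (A \<union> B)) + 4 \<le> 2 * card (A \<union> B)"
      using room that by simp
    ultimately show False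
      using card_induced_edges_Un[OF fin(4), of A B] card_Un_Int[OF \<open>finite A\<close> \<open>finite B\<close>] that(5,6)
      by linarith
  qed
  have XY: "card (X \<inter> Y) = 1" by (rule meet) (use assms in auto)
  have XZ: "card (X \<inter> Z) = 1" by (rule meet) (use assms in auto)
  have YZ: "card (Y \<inter> Z) = 1" by (rule meet) (use assms in auto)
  have singleton: "A = {x}" if "card A = 1" "x \<in> A" for A :: "'v set" and x
    using that by (metis card_1_singletonE singletonD)
  have "X \<inter> Y = {b}" "X \<inter> Z = {a}" "Y \<inter> Z = {c}"
    using singleton XY XZ YZ assms(6-11) by simp_all
  then have "(X \<union> Y) \<inter> Z = {a, c}" by blast
  then have "card ((X \<union> Y) \<inter> Z) = 2" using assms(12) by simp
  \<comment> \<open>The union has 3 vertices fewer than the sum, and its edges number at least 2(|X|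
    + |Y| + |Z|) - 9. That is twice the size of the union minus 3, one more than \<open>room\<close>
    allows.\<close>
  then have cards: "card (X \<union> Y \<union> Z) + 3 = card X + card Y + card Z"
    using card_Un_Int[OF fin(1,2)] card_Un_Int[of "X \<union> Y" Z] fin XY by simp
  have disj: "induced_edges E X \<inter> induced_edges E Y = {}" "(induced_edges E X \<union> induced_edges E Y) \<inter> induced_edges E Z = {}"
  proof -
    have "induced_edges E (X \<inter> Y) = {}" "induced_edges E (X \<inter> Z) = {}" "induced_edges E (Y \<inter> Z) = {}"
      using small[OF le_infI1[OF assms(3)], of Y] small[OF le_infI1[OF assms(3)], of Z]
        small[OF le_infI1[OF assms(4)], of Z] XY XZ YZ by simp_all
    then show "induced_edges E X \<inter> induced_edges E Y = {}"
        "(induced_edges E X \<union> induced_edges E Y) \<inter> induced_edges E Z = {}"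
      unfolding induced_edges_def by blast+
  qed
  have fi: "finite (induced_edges E A)" for A
    using fin(4) induced_edges_subset finite_subset by blast
  have "card (induced_edges E X) + card (induced_edges E Y) + card (induced_edges E Z)
    = card (induced_edges E X \<union> induced_edges E Y \<union> induced_edges E Z)"
    using disj fi by (simp add: card_Un_disjoint)
  also have "\<dots> \<le> card (induced_edges E (X \<union> Y \<union> Z))"
    by (intro card_mono fi) (auto simp: induced_edges_def)
  finally show False
    using room[of "X \<union> Y \<union> Z"] cards assms(3-11,13-15) by force
qed

lemma blocking_set_if_not_addable:
  assumes "bicoloured_graph V E" "sparse_2_3 V E" "a \<in> V" "b \<in> V" "a \<noteq> b"
    and "(c, {a, b}) \<in> E \<or> \<not> sparse_2_3 V (insert (c, {a, b}) E)"
  shows "\<exists>X\<subseteq>V. a \<in> X \<and> b \<in> X \<and> 2 * card X \<le> card (induced_edges E X) + 3"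
proof (cases "(c, {a, b}) \<in> E")
  case True
  \<comment> \<open>An edge already present makes its own pair of ends tight, since 1 = 2 * 2 -
    3.\<close>
  then have "induced_edges E {a, b} \<noteq> {}" by (auto simp: induced_edges_def)
  moreover have "finite (induced_edges E {a, b})"
    using bicoloured_graph_finite[OF assms(1)] induced_edges_subset finite_subset by blast
  ultimately have "card (induced_edges E {a, b}) \<ge> 1"
    by (simp add: Suc_leI card_gt_0_iff)
  then show ?thesis
    using assms(3-5) by (intro exI[of _ "{a, b}"]) simp
next
  case False
  let ?E = "insert (c, {a, b}) E"
  show ?thesis
  proof (rule ccontr)
    assume no: "\<not> ?thesis"
    have "bicoloured_graph V ?E"
      using assms(1,3,4) complete_edgesI by (auto simp: bicoloured_graph_def)
    then have "sparse_2_3 V ?E"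
    proof (rule sparseI)
      fix X assume X: "X \<subseteq> V" "induced_edges ?E X \<noteq> {}"
      show "card (induced_edges ?E X) + 3 \<le> 2 * card X"
      proof (cases "a \<in> X \<and> b \<in> X")
        case True
        then have "card (induced_edges E X) + 3 < 2 * card X" using no X by force
        moreover have "induced_edges ?E X = insert (c, {a, b}) (induced_edges E X)"
          using True by (auto simp: induced_edges_def)
        moreover have "finite (induced_edges E X)"
          using bicoloured_graph_finite[OF assms(1)] induced_edges_subset finite_subset by blast
        ultimately show ?thesis
          by (simp add: card_insert_if split: if_splits)
      next
        case False
        then have "induced_edges ?E X = induced_edges E X" by (auto simp: induced_edges_def)
        then show ?thesis using sparse_induced_edges[OF assms(1,2) X(1)] X(2) by simp
      qed
    qed
    with assms(6) False show False by blast
  qed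
qed

definition star :: "'v edge set \<Rightarrow> 'v \<Rightarrow> 'v edge set" where
  "star E v = {e \<in> E. v \<in> snd e}"

text \<open>One vertex spans no edge, which excludes loops, and two vertices span at most one, which
  excludes parallel edges. So neighbours may stand for incident edges.\<close>

lemma sparse_star:
  assumes "bicoloured_graph V E" "sparse_2_3 V E" "v \<in> V"
  shows "\<exists>nb. inj_on nb (star E v) \<and> (\<forall>e\<in>star E v. snd e = {v, nb e} \<and> nb e \<in> V - {v})"
proof -
  have "\<exists>w. snd e = {v, w} \<and> w \<in> V - {v}" if "e \<in> star E v" for e
  proof -
    have "e \<in> complete_edges V" "v \<in> snd e" "e \<in> E"
      using that assms(1) by (auto simp: star_def bicoloured_graph_def)
    obtain c x y where "e = (c, {x, y})" "x \<in> V" "y \<in> V"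
      using \<open>e \<in> complete_edges V\<close> by (rule complete_edgesE)
    then have "snd e = {v, if v = x then y else x} \<and> (if v = x then y else x) \<in> V"
      using \<open>v \<in> snd e\<close> by auto
    then obtain w where w: "snd e = {v, w}" "w \<in> V" by blast
    have "w \<noteq> v"
    proof
      assume "w = v"
      then have "e \<in> induced_edges E {v}"
        using w \<open>e \<in> E\<close> by (simp add: induced_edges_def)
      then have "induced_edges E {v} \<noteq> {}" by blast
      then show False
        using sparse_induced_edges[OF assms(1,2), of "{v}"] assms(3) by simp
    qed
    with w show ?thesis by blast
  qed
  then obtain nb where nb: "\<forall>e\<in>star E v. snd e = {v, nb e} \<and> nb e \<in> V - {v}"
    by metis
  moreover have "inj_on nb (star E v)"
  proof (rule inj_onI, rule ccontr)
    fix e f assume ef: "e \<in> star E v" "f \<in> star E v" "nb e = nb f" "e \<noteq> f"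
    have ends: "snd e = {v, nb e}" "snd f = {v, nb e}" "nb e \<in> V"
      using bspec[OF nb ef(1)] bspec[OF nb ef(2)] ef(3) by auto
    then have "{e, f} \<subseteq> induced_edges E {v, nb e}"
      using ef(1,2) by (simp add: induced_edges_def star_def)
    moreover have "finite (induced_edges E {v, nb e})"
      using bicoloured_graph_finite[OF assms(1)] induced_edges_subset finite_subset by blast
    ultimately have "2 \<le> card (induced_edges E {v, nb e})" "induced_edges E {v, nb e} \<noteq> {}"
      using card_mono[of "induced_edges E {v, nb e}" "{e, f}"] ef(4) by auto
    then show False
      using sparse_induced_edges[OF assms(1,2), of "{v, nb e}"] ends(3) assms(3)
      by (simp add: card_insert_if split: if_splits)
  qed
  ultimately show ?thesis by blast
qed

text \<open>If all degrees were at least 4, counting incidences would give 4|V| <= 2|E| <= 4|V| -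
  6.\<close>

lemma sparse_low_degree:
  assumes "bicoloured_graph V E" "sparse_2_3 V E" "E \<noteq> {}"
  shows "\<exists>v\<in>V. card (star E v) \<le> 3"
proof (rule ccontr)
  assume "\<not> ?thesis"
  then have "4 \<le> card (star E v)" if "v \<in> V" for v using that by force
  then have "4 * card V \<le> (\<Sum>v\<in>V. card (star E v))"
    using sum_mono[of V "\<lambda>_. 4" "\<lambda>v. card (star E v)"] by (simp add: mult.commute)
  also have "\<dots> = (\<Sum>v\<in>V. \<Sum>e\<in>E. if v \<in> snd e then 1 else 0)"
    using bicoloured_graph_finite[OF assms(1)] by (simp add: star_def sum.If_cases Int_def)
  also have "\<dots> = (\<Sum>e\<in>E. \<Sum>v\<in>V. if v \<in> snd e then 1 else 0)"
    by (rule sum.swap)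
  also have "\<dots> \<le> (\<Sum>e\<in>E. 2)"
  proof (rule sum_mono)
    fix e assume "e \<in> E"
    then have "e \<in> complete_edges V" using assms(1) by (auto simp: bicoloured_graph_def)
    then obtain c v w where "e = (c, {v, w})" "v \<in> V" "w \<in> V" by (rule complete_edgesE)
    moreover have "(\<Sum>v\<in>V. if v \<in> snd e then 1 else 0) = card (V \<inter> snd e)"
      using bicoloured_graph_finite[OF assms(1)] by (simp add: sum.If_cases)
    ultimately show "(\<Sum>v\<in>V. if v \<in> snd e then 1 else 0) \<le> (2::nat)"
      by (simp add: card_insert_if)
  qed
  finally have "4 * card V \<le> 2 * card E" by simp
  moreover have "induced_edges E V = E"
    using assms(1) complete_edges_ends[of _ V] by (auto simp: induced_edges_def bicoloured_graph_def)
  ultimately show False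
    using sparse_induced_edges[OF assms(1,2), of V] assms(3) by simp
qed

lemma delete_vertex:
  assumes "bicoloured_graph V E"
  shows "bicoloured_graph (V - {v}) (E - star E v)"
proof -
  have "e \<in> complete_edges (V - {v})" if "e \<in> E - star E v" for e
  proof (rule complete_edges_restrict)
    show "e \<in> complete_edges V" using that assms by (auto simp: bicoloured_graph_def)
    from complete_edges_ends[OF this] show "snd e \<subseteq> V - {v}"
      using that by (auto simp: star_def)
  qed
  then show ?thesis
    using assms unfolding bicoloured_graph_def by auto
qed

text \<open>If no pair of neighbours could be joined, each pair would lie in a tight set, against
  \<open>no_three_blocking_sets\<close>. A blue edge suffices, since neither sparsity nor pair rates
  distinguish colours.\<close>

lemma sparse_split_degree_3:
  assumes "bicoloured_graph V E" "sparse_2_3 V E" "v \<in> V"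
    and "\<And>e. e \<in> star E v \<Longrightarrow> snd e = {v, nb e} \<and> nb e \<in> V - {v}"
    and "nb ` star E v = {a, b, c}" "distinct [a, b, c]" "card (star E v) = 3"
  shows "\<exists>x y. {x, y} \<subseteq> {a, b, c} \<and> x \<noteq> y \<and> (Blue, {x, y}) \<notin> E - star E v \<and>
    sparse_2_3 (V - {v}) (insert (Blue, {x, y}) (E - star E v))"
proof (rule ccontr)
  let ?V = "V - {v}" and ?E = "E - star E v"
  assume no: "\<not> ?thesis"
  have g: "bicoloured_graph ?V ?E"
    by (rule delete_vertex[OF assms(1)])
  then have sp: "sparse_2_3 ?V ?E"
    using sparse_subgraph[OF assms(2), of ?V ?E] by (simp add: subgraph_def)
  have "nb ` star E v \<subseteq> ?V"
    using assms(4) by (intro image_subsetI) simp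
  then have abc: "a \<in> ?V" "b \<in> ?V" "c \<in> ?V"
    using assms(5) by auto
  have block: "\<exists>X\<subseteq>?V. x \<in> X \<and> y \<in> X \<and> 2 * card X \<le> card (induced_edges ?E X) + 3"
    if "{x, y} \<subseteq> {a, b, c}" "x \<noteq> y" for x y
  proof (rule blocking_set_if_not_addable[OF g sp, where c = Blue])
    show "x \<in> ?V" "y \<in> ?V" "x \<noteq> y" using that abc by auto
    show "(Blue, {x, y}) \<in> ?E \<or> \<not> sparse_2_3 ?V (insert (Blue, {x, y}) ?E)"
      using no that by meson
  qed
  obtain X where X: "X \<subseteq> ?V" "a \<in> X" "b \<in> X" "2 * card X \<le> card (induced_edges ?E X) + 3"
    using block[of a b] assms(6) by auto
  obtain Y where Y: "Y \<subseteq> ?V" "b \<in> Y" "c \<in> Y" "2 * card Y \<le> card (induced_edges ?E Y) + 3"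
    using block[of b c] assms(6) by auto
  obtain Z where Z: "Z \<subseteq> ?V" "a \<in> Z" "c \<in> Z" "2 * card Z \<le> card (induced_edges ?E Z) + 3"
    using block[of a c] assms(6) by auto
  \<comment> \<open>Putting \<open>v\<close> back adds one vertex and three edges, so the sparsity
    bound leaves one unit of slack on \<open>U\<close>.\<close>
  have "card (induced_edges ?E U) + 4 \<le> 2 * card U" if U: "U \<subseteq> ?V" "{a, b, c} \<subseteq> U" for U
  proof -
    have fin: "finite E" "finite U"
      using bicoloured_graph_finite[OF assms(1)] U finite_subset by blast+
    have "star E v \<union> induced_edges ?E U \<subseteq> induced_edges E (insert v U)"
    proof -
      have "snd e \<subseteq> insert v U" if "e \<in> star E v" for e
        using assms(4)[OF that] imageI[OF that, of nb] assms(5) U(2) by auto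
      then show ?thesis by (auto simp: induced_edges_def star_def)
    qed
    then have "card (star E v \<union> induced_edges ?E U) \<le> card (induced_edges E (insert v U))"
      using fin by (intro card_mono) (auto simp: induced_edges_def)
    moreover have "card (star E v \<union> induced_edges ?E U) = 3 + card (induced_edges ?E U)"
      using fin assms(7) by (subst card_Un_disjoint) (auto simp: induced_edges_def star_def)
    moreover have "card (induced_edges E (insert v U)) + 3 \<le> 2 * card (insert v U)"
    proof (rule sparse_induced_edges[OF assms(1,2)])
      show "insert v U \<subseteq> V" using U assms(3) by blast
      show "induced_edges E (insert v U) \<noteq> {}"
        using calculation by force
    qed
    moreover have "card (insert v U) = card U + 1"
      using U(1) fin(2) by (subst card_insert_disjoint) auto
    ultimately show ?thesis by linarith
  qed
  then show False
    by (rule no_three_blocking_sets[OF g sp X(1) Y(1) Z(1) X(2,3) Y(2,3) Z(2,3) assms(6) X(4) Y(4) Z(4)])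
qed

section \<open>Henneberg moves\<close>

lemma pair_rate_fun_upd:
  assumes "e \<in> complete_edges W" "v \<notin> W"
  shows "pair_rate (p(v := z)) (u(v := y)) (snd e) = pair_rate p u (snd e)"
proof -
  obtain c a b where "e = (c, {a, b})" "a \<in> W" "b \<in> W"
    using assms(1) by (rule complete_edgesE)
  then show ?thesis using assms(2) by auto
qed

lemma pair_rate_zero: "pair_rate p (\<lambda>_. 0) e = 0"
  by (simp add: pair_rate_def split: prod.split)

lemma tangent_fields_fun_upd:
  assumes "u \<in> tangent_fields (W - {v}) p" "z \<bullet> y = 0"
  shows "u(v := y) \<in> tangent_fields W (p(v := z))"
  using assms by (auto simp: tangent_fields_def)

lemma sum_rates_attach:
  assumes "F0 \<subseteq> complete_edges (W - {v})" "finite F0" "finite D" "F0 \<inter> D = {}"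
    and "\<And>e. e \<in> D \<Longrightarrow> snd e = {v, nb e} \<and> nb e \<noteq> v"
  shows "(\<Sum>e\<in>F0 \<union> D. s e * pair_rate (p(v := z)) (u(v := y)) (snd e))
    = (\<Sum>e\<in>F0. s e * pair_rate p u (snd e)) + (\<Sum>e\<in>D. s e * (z \<bullet> u (nb e) + p (nb e) \<bullet> y))"
proof -
  have "(\<Sum>e\<in>F0. s e * pair_rate (p(v := z)) (u(v := y)) (snd e)) = (\<Sum>e\<in>F0. s e * pair_rate p u (snd e))"
    using assms(1) by (intro sum.cong refl arg_cong2[of _ _ _ _ "(*)"] pair_rate_fun_upd[of _ "W - {v}"]) auto
  moreover have "(\<Sum>e\<in>D. s e * pair_rate (p(v := z)) (u(v := y)) (snd e))
      = (\<Sum>e\<in>D. s e * (z \<bullet> u (nb e) + p (nb e) \<bullet> y))"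
    using assms(5) by (intro sum.cong refl) simp
  ultimately show ?thesis
    using assms(2-4) by (simp add: sum.union_disjoint)
qed

text \<open>Velocities moving only \<open>v\<close> kill the stresses on \<open>D\<close> one by
  one, through a tangent vector at \<open>z\<close> dual to each neighbour; what remains is a stress
  of the smaller graph.\<close>

lemma stress_free_attach:
  assumes "F0 \<subseteq> complete_edges (W - {v})" "finite F0" "finite D" "F0 \<inter> D = {}"
    and nb: "\<And>e. e \<in> D \<Longrightarrow> snd e = {v, nb e} \<and> nb e \<noteq> v"
    and "stress_free (W - {v}) F0 p"
    and dual: "\<And>e. e \<in> D \<Longrightarrow> \<exists>y. z \<bullet> y = 0 \<and> p (nb e) \<bullet> y \<noteq> 0 \<and> (\<forall>e'\<in>D - {e}. p (nb e') \<bullet> y = 0)"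
  shows "stress_free W (F0 \<union> D) (p(v := z))"
  unfolding independent_on_def
proof (intro allI impI)
  fix s assume s: "\<forall>u\<in>tangent_fields W (p(v := z)).
    (\<Sum>e\<in>F0 \<union> D. s e * pair_rate (p(v := z)) u (snd e)) = 0"
  have eq: "(\<Sum>e\<in>F0. s e * pair_rate p u (snd e)) + (\<Sum>e\<in>D. s e * (z \<bullet> u (nb e) + p (nb e) \<bullet> y)) = 0"
    if "u \<in> tangent_fields (W - {v}) p" "z \<bullet> y = 0" for u y
    using bspec[OF s tangent_fields_fun_upd[OF that]]
    by (simp only: sum_rates_attach[OF assms(1-4) nb])
  have D: "s e = 0" if "e \<in> D" for e
  proof -
    obtain y where y: "z \<bullet> y = 0" "p (nb e) \<bullet> y \<noteq> 0" "\<forall>e'\<in>D - {e}. p (nb e') \<bullet> y = 0"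
      using dual[OF \<open>e \<in> D\<close>] by blast
    have "(\<lambda>_. 0) \<in> tangent_fields (W - {v}) p" by (simp add: tangent_fields_def)
    from eq[OF this y(1)] have "(\<Sum>e\<in>D. s e * (p (nb e) \<bullet> y)) = 0"
      by (simp add: pair_rate_zero)
    moreover have "(\<Sum>e\<in>D - {e}. s e * (p (nb e) \<bullet> y)) = 0"
      using y(3) by (intro sum.neutral) auto
    ultimately show ?thesis
      using sum.remove[OF assms(3) that, of "\<lambda>e. s e * (p (nb e) \<bullet> y)"] y(2) by simp
  qed
  have "(\<Sum>e\<in>F0. s e * pair_rate p u (snd e)) = 0" if "u \<in> tangent_fields (W - {v}) p" for u
    using eq[OF that, of 0] D by simp
  then show "\<forall>e\<in>F0 \<union> D. s e = 0"
    using independent_onD[OF assms(6), of s] D by auto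
qed

text \<open>The new vertex lies on the great circle through \<open>p a\<close> and \<open>p b\<close>, at their normalised
  midpoint, so that the two edges to \<open>a\<close> and \<open>b\<close> carry equal stresses and together act like the
  removed edge.\<close>

lemma stress_free_split:
  assumes "F0 \<subseteq> complete_edges (W - {v})" "finite F0" "finite D" "F0 \<inter> D = {}"
    and nb: "\<And>e. e \<in> D \<Longrightarrow> snd e = {v, nb e} \<and> nb e \<noteq> v"
    and D: "D = {ea, eb, ec}" "distinct [ea, eb, ec]" "nb ea = a" "nb eb = b" "nb ec = c"
    and ab: "(Blue, {a, b}) \<notin> F0" "a \<in> W" "b \<in> W"
    and sf: "stress_free (W - {v}) (insert (Blue, {a, b}) F0) p"
    and unit: "norm (p a) = 1" "norm (p b) = 1" "p a \<noteq> p b"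
    and y: "p a \<bullet> y = 0" "p b \<bullet> y = 0" "p c \<bullet> y \<noteq> 0"
    and z: "z = k *\<^sub>R (p a + p b)" "k \<noteq> 0"
  shows "stress_free W (F0 \<union> D) (p(v := z))"
  unfolding independent_on_def
proof (intro allI impI)
  fix s assume s: "\<forall>u\<in>tangent_fields W (p(v := z)).
    (\<Sum>e\<in>F0 \<union> D. s e * pair_rate (p(v := z)) u (snd e)) = 0"
  have eq: "(\<Sum>e\<in>F0. s e * pair_rate p u (snd e)) + s ea * (z \<bullet> u a + p a \<bullet> y)
      + s eb * (z \<bullet> u b + p b \<bullet> y) + s ec * (z \<bullet> u c + p c \<bullet> y) = 0"
    if "u \<in> tangent_fields (W - {v}) p" "z \<bullet> y = 0" for u y
  proof -
    have "(\<Sum>e\<in>F0. s e * pair_rate p u (snd e)) + (\<Sum>e\<in>D. s e * (z \<bullet> u (nb e) + p (nb e) \<bullet> y)) = 0"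
      using bspec[OF s tangent_fields_fun_upd[OF that]]
      by (simp only: sum_rates_attach[OF assms(1-4) nb])
    then show ?thesis using D(2-5) unfolding D(1) by simp
  qed
  have zero: "(\<lambda>_. 0) \<in> tangent_fields (W - {v}) p" by (simp add: tangent_fields_def)
  \<comment> \<open>Moving \<open>v\<close> along \<open>y\<close>, off the circle through
    \<open>p a\<close> and \<open>p b\<close>, is felt only by \<open>ec\<close>.\<close>
  have "z \<bullet> y = 0" using y z by (simp add: inner_add_left)
  from eq[OF zero this] have sc: "s ec = 0"
    using y by (simp add: pair_rate_zero)
  \<comment> \<open>The chord \<open>p a - p b\<close> is tangent at the midpoint and meets
    \<open>p a\<close> and \<open>p b\<close> with opposite inner products, so moving
    \<open>v\<close> along it equates the stresses on \<open>ea\<close> and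
    \<open>eb\<close>.\<close>
  have nz: "p a \<bullet> (p a - p b) \<noteq> 0" "p b \<bullet> (p a - p b) = - (p a \<bullet> (p a - p b))"
  proof -
    have "(p a - p b) \<bullet> (p a - p b) \<noteq> 0" using unit(3) by simp
    then show "p a \<bullet> (p a - p b) \<noteq> 0" "p b \<bullet> (p a - p b) = - (p a \<bullet> (p a - p b))"
      using unit(1,2) by (auto simp: algebra_simps inner_commute norm_eq_1)
  qed
  then have "z \<bullet> (p a - p b) = 0" using z by (simp add: inner_add_left)
  from eq[OF zero this] have "(s ea - s eb) * (p a \<bullet> (p a - p b)) = 0"
    unfolding nz(2) using sc by (simp add: pair_rate_zero algebra_simps)
  then have sab: "s ea = s eb" using nz(1) by simp
  \<comment> \<open>By tangency at \<open>a\<close> and \<open>b\<close>, the rates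
    \<open>z \<bullet> u a + z \<bullet> u b\<close> add up to \<open>k\<close> times the pair rate
    of the removed edge.\<close>
  define s' where "s' = s((Blue, {a, b}) := s ea * k)"
  have av: "a \<in> W - {v}" "b \<in> W - {v}" using ab(2,3) nb[of ea] nb[of eb] D by auto
  have "(\<Sum>e\<in>insert (Blue, {a, b}) F0. s' e * pair_rate p u (snd e)) = 0"
    if u: "u \<in> tangent_fields (W - {v}) p" for u
  proof -
    have "p a \<bullet> u a = 0" "p b \<bullet> u b = 0" using u av by (auto simp: tangent_fields_def)
    then have "z \<bullet> u a + z \<bullet> u b = k * pair_rate p u {a, b}"
      using z by (simp add: algebra_simps)
    moreover have "(\<Sum>e\<in>F0. s' e * pair_rate p u (snd e)) = (\<Sum>e\<in>F0. s e * pair_rate p u (snd e))"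
      using ab(1) by (intro sum.cong) (auto simp: s'_def)
    moreover have "(\<Sum>e\<in>F0. s e * pair_rate p u (snd e)) + s ea * (z \<bullet> u a + z \<bullet> u b) = 0"
      using eq[OF u, of 0] sc sab by (simp add: distrib_left)
    moreover have "(\<Sum>e\<in>insert (Blue, {a, b}) F0. s' e * pair_rate p u (snd e))
        = s ea * k * pair_rate p u {a, b} + (\<Sum>e\<in>F0. s' e * pair_rate p u (snd e))"
      using ab(1) assms(2) by (simp add: s'_def del: pair_rate_pair)
    ultimately show ?thesis
      by (simp only: mult.assoc add.commute)
  qed
  then have all: "s' e = 0" if "e \<in> insert (Blue, {a, b}) F0" for e
    using independent_onD[OF sf _ that] by blast
  have "s ea = 0" using all[of "(Blue, {a, b})"] z(2) by (simp add: s'_def)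
  moreover have "s e = 0" if "e \<in> F0" for e
    using all[of e] that ab(1) by (auto simp: s'_def split: if_splits)
  ultimately show "\<forall>e\<in>F0 \<union> D. s e = 0"
    using D sc sab by auto
qed

lemma generic_fun_upd:
  assumes gen: "generic (W - {v}) F0 p" and "norm z = 1" "v \<in> W"
    and D: "\<And>e. e \<in> D \<Longrightarrow> snd e = {v, nb e} \<and> nb e \<in> W - {v}"
    and avoid: "\<And>e. e \<in> D \<Longrightarrow> p (nb e) \<noteq> z \<and> p (nb e) \<noteq> - z"
    and graph: "bicoloured_graph W (F0 \<union> D)"
  shows "generic W (F0 \<union> D) (p(v := z))"
  unfolding generic_def
proof (intro conjI allI impI; (elim conjE)?)
  show "bicoloured_graph W (F0 \<union> D)" by (rule graph)
  show "(p(v := z)) ` W \<subseteq> S2"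
    using assms(2) gen by (auto simp: generic_def)
  fix c x y assume e: "(c, {x, y}) \<in> F0 \<union> D" "x \<noteq> y"
  have "(p(v := z)) x \<noteq> (p(v := z)) y \<and> (p(v := z)) x \<noteq> - (p(v := z)) y"
  proof (cases "(c, {x, y}) \<in> F0")
    case True
    then have "(c, {x, y}) \<in> complete_edges (W - {v})"
      using gen by (auto simp: generic_def bicoloured_graph_def)
    from complete_edges_ends[OF this] have "x \<noteq> v" "y \<noteq> v" by auto
    moreover have "p x \<noteq> p y \<and> p x \<noteq> - p y"
      using gen True e(2) unfolding generic_def by blast
    ultimately show ?thesis by simp
  next
    case False
    then have "(c, {x, y}) \<in> D" using e(1) by blast
    note nb = D[OF this] and av = avoid[OF this]
    then consider "x = v" "y = nb (c, {x, y})" | "y = v" "x = nb (c, {x, y})"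
      by (auto simp: doubleton_eq_iff)
    then show ?thesis
      using av nb by cases (metis DiffD2 fun_upd_apply insertI1 minus_equation_iff)+
  qed
  then show "(p(v := z)) x \<noteq> (p(v := z)) y" "(p(v := z)) x \<noteq> - (p(v := z)) y" by auto
qed

lemma stress_free_attach_regular:
  assumes reg: "completely_regular V p" and sub: "subgraph W (F0 \<union> D) V (complete_edges V)"
    and F0: "F0 \<subseteq> complete_edges (W - {v})" "F0 \<inter> D = {}" "stress_free (W - {v}) F0 p"
    and v: "v \<in> W" and nb: "\<And>e. e \<in> D \<Longrightarrow> snd e = {v, nb e} \<and> nb e \<in> W - {v}"
    and inj: "inj_on nb D" and card: "card D \<le> 2"
  shows "stress_free W (F0 \<union> D) p"
proof -
  have gr: "bicoloured_graph W (F0 \<union> D)" using sub by (simp add: subgraph_def)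
  then have fin: "finite F0" "finite D" "finite W" using bicoloured_graph_finite by blast+
  have WV: "W \<subseteq> V" using sub by (simp add: subgraph_def)
  have sub': "subgraph (W - {v}) (complete_edges (W - {v})) V (complete_edges V)"
    using WV fin complete_edges_mono[of "W - {v}" V] by (auto simp: subgraph_def bicoloured_graph_def)
  have genc: "generic (W - {v}) (complete_edges (W - {v})) p"
    by (rule completely_regular_generic[OF reg sub'])
  then have gen: "generic (W - {v}) F0 p"
    using F0(1) fin unfolding generic_def bicoloured_graph_def by blast
  have unit: "norm (p w) = 1" if "w \<in> W - {v}" for w
    using genc that by (auto simp: generic_def)
  have sep: "p x \<noteq> p y \<and> p x \<noteq> - p y" if "x \<in> W - {v}" "y \<in> W - {v}" "x \<noteq> y" for x y
    using genc that complete_edgesI[OF that(1,2), of Blue] unfolding generic_def by metis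
  let ?S = "p ` nb ` D"
  have "card ?S \<le> card D" using fin(2) by (metis card_image_le finite_imageI le_trans)
  then have "dim ?S < DIM(real ^ 3)" using dim_le_card'[of ?S] fin card by simp
  then obtain x where x: "x \<noteq> 0" "\<And>y. y \<in> span ?S \<Longrightarrow> orthogonal x y"
    using orthogonal_to_subspace_exists by blast
  \<comment> \<open>A pole of the neighbours: their position vectors are then tangent at
    \<open>z\<close>, and none of them equals \<open>z\<close> or \<open>- z\<close>.\<close>
  define z where "z = x /\<^sub>R norm x"
  have z: "norm z = 1" "\<And>e. e \<in> D \<Longrightarrow> z \<bullet> p (nb e) = 0"
    using x by (auto simp: z_def orthogonal_def span_base)
  have "stress_free W (F0 \<union> D) (p(v := z))"
  proof (rule stress_free_attach[OF F0(1) fin(1,2) F0(2) _ F0(3)])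
    show "snd e = {v, nb e} \<and> nb e \<noteq> v" if "e \<in> D" for e using nb[OF that] by auto
    fix e assume e: "e \<in> D"
    show "\<exists>y. z \<bullet> y = 0 \<and> p (nb e) \<bullet> y \<noteq> 0 \<and> (\<forall>e'\<in>D - {e}. p (nb e') \<bullet> y = 0)"
    proof (cases "D = {e}")
      case True
      then show ?thesis
        using z(2)[OF e] unit[of "nb e"] nb[OF e] by (intro exI[of _ "p (nb e)"]) (auto simp: norm_eq_1)
    next
      case False
      then obtain f where f: "f \<in> D" "f \<noteq> e" using e by blast
      have "D = {e, f}"
        using card_subset_eq[of D "{e, f}"] card fin(2) e f card_mono[of D "{e, f}"] by auto
      have "nb e \<noteq> nb f" using inj e f by (auto dest: inj_onD)
      then have "\<bar>p (nb e) \<bullet> p (nb f)\<bar> < 1"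
        using unit_inner_abs_less_1 unit sep nb[OF e] nb[OF f(1)] by blast
      then have "(p (nb e) \<bullet> p (nb f))\<^sup>2 < 1" by (simp add: abs_square_less_1)
      \<comment> \<open>The dual vector is the component of \<open>p (nb e)\<close> orthogonal to
        \<open>p (nb f)\<close>; its product with \<open>p (nb e)\<close> is 1 minus the squared
        cosine.\<close>
      then show ?thesis
        using z(2)[OF e] z(2)[OF f(1)] unit[of "nb e"] unit[of "nb f"] nb[OF e] nb[OF f(1)] \<open>D = {e, f}\<close>
        by (intro exI[of _ "p (nb e) - (p (nb e) \<bullet> p (nb f)) *\<^sub>R p (nb f)"])
          (auto simp: norm_eq_1 inner_diff_right inner_commute power2_eq_square)
    qed
  qed
  moreover have "generic W (F0 \<union> D) (p(v := z))"
  proof (rule generic_fun_upd[OF gen z(1) v nb _ gr])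
    fix e assume "e \<in> D"
    then show "p (nb e) \<noteq> z \<and> p (nb e) \<noteq> - z"
      using z by (metis inner_minus_right neg_equal_0_iff_equal norm_eq_1 zero_neq_one minus_minus)
  qed auto
  ultimately show ?thesis
    using completely_regular_stress_free[OF reg sub] by blast
qed

lemma independent_on_empty: "independent_on T {} r"
  by (simp add: independent_on_def)

text \<open>If \<open>p c\<close> were on the great circle through \<open>p a\<close> and \<open>p b\<close>, say \<open>p c = \<alpha> p a + \<beta> p b\<close>,
  then the stresses \<open>\<alpha>\<close>, \<open>\<beta>\<close>, \<open>- \<alpha> \<beta>\<close> on \<open>ac\<close>, \<open>bc\<close>, \<open>ab\<close> would cancel.\<close>

lemma completely_regular_not_coplanar:
  assumes reg: "completely_regular V p" and V: "{a, b, c} \<subseteq> V" "distinct [a, b, c]"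
  shows "\<exists>y. p a \<bullet> y = 0 \<and> p b \<bullet> y = 0 \<and> p c \<bullet> y \<noteq> 0"
proof (rule ccontr)
  assume no: "\<not> ?thesis"
  let ?ab = "(Blue, {b, a})" and ?ac = "(Blue, {c, a})" and ?bc = "(Blue, {c, b})"
  have distinct: "?ac \<noteq> ?bc" "?ab \<noteq> ?ac" "?ab \<noteq> ?bc"
    using V(2) by (auto simp: doubleton_eq_iff)
  have ab: "stress_free {a, b} ({} \<union> {?ab}) p"
  proof (rule stress_free_attach_regular[OF reg, where v = b and nb = "\<lambda>_. a"])
    show "subgraph {a, b} ({} \<union> {?ab}) V (complete_edges V)"
      using V by (auto simp: subgraph_def bicoloured_graph_def intro!: complete_edgesI)
  qed (use V in \<open>auto simp: independent_on_empty\<close>)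
  \<comment> \<open>The triangle is obtained by attaching \<open>b\<close> to \<open>a\<close> and
    then \<open>c\<close> to both. These moves do not presuppose that the three points are off a
    common great circle, so the argument is not circular.\<close>
  have "stress_free {a, b, c} ({?ab} \<union> {?ac, ?bc}) p"
  proof (rule stress_free_attach_regular[OF reg, where v = c and nb = "\<lambda>e. if e = ?ac then a else b"])
    show "subgraph {a, b, c} ({?ab} \<union> {?ac, ?bc}) V (complete_edges V)"
      using V by (auto simp: subgraph_def bicoloured_graph_def intro!: complete_edgesI)
    show "{?ab} \<subseteq> complete_edges ({a, b, c} - {c})"
      using V by (auto intro!: complete_edgesI)
    have "{a, b, c} - {c} = {a, b}" using V by auto
    then show "stress_free ({a, b, c} - {c}) {?ab} p" using ab by simp
  qed (use V distinct in \<open>auto simp: inj_on_def\<close>)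
  note sf = this
  obtain x y where xy: "x \<in> span {p a, p b}" "\<And>w. w \<in> span {p a, p b} \<Longrightarrow> orthogonal y w" "p c = x + y"
    using orthogonal_subspace_decomp_exists by blast
  have "p a \<bullet> y = 0" "p b \<bullet> y = 0" "x \<bullet> y = 0"
    using xy(2)[of "p a"] xy(2)[of "p b"] xy(2)[OF xy(1)] by (simp_all add: orthogonal_def span_base inner_commute)
  then have "y = 0"
    using no xy(3) by (auto simp: inner_add_left)
  then obtain \<alpha> \<beta> where pc: "p c = \<alpha> *\<^sub>R p a + \<beta> *\<^sub>R p b"
    using xy(1,3) by (auto simp: span_insert algebra_simps)
  let ?s = "\<lambda>e. if e = ?ac then \<alpha> else if e = ?bc then \<beta> else - (\<alpha> * \<beta>)"
  have "(\<Sum>e\<in>{?ab} \<union> {?ac, ?bc}. ?s e * pair_rate p u (snd e)) = 0"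
    if "u \<in> tangent_fields {a, b, c} p" for u
  proof -
    have t: "p a \<bullet> u a = 0" "p b \<bullet> u b = 0" "p c \<bullet> u c = 0"
      using that by (auto simp: tangent_fields_def)
    have "(\<Sum>e\<in>{?ab} \<union> {?ac, ?bc}. ?s e * pair_rate p u (snd e))
      = \<alpha> * (p c \<bullet> u a + p a \<bullet> u c) + \<beta> * (p c \<bullet> u b + p b \<bullet> u c) - \<alpha> * \<beta> * (p b \<bullet> u a + p a \<bullet> u b)"
      using distinct by simp
    also have "\<dots> = p c \<bullet> u c + \<alpha> * \<alpha> * (p a \<bullet> u a) + \<beta> * \<beta> * (p b \<bullet> u b)"
      unfolding pc by (simp add: algebra_simps)
    finally show ?thesis using t by simp
  qed
  then have "?s e = 0" if "e \<in> {?ab} \<union> {?ac, ?bc}" for e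
    using independent_onD[OF sf, of ?s, OF _ that] by simp
  from this[of ?ac] this[of ?bc] have "\<alpha> = 0" "\<beta> = 0" using distinct by auto
  then have "p c = 0" using pc by simp
  moreover have "subgraph {c} {} V (complete_edges V)"
    using V by (auto simp: subgraph_def bicoloured_graph_def)
  then have "norm (p c) = 1"
    using completely_regular_generic[OF reg] by (fastforce simp: generic_def)
  ultimately show False by simp
qed

lemma completely_regular_separated:
  assumes reg: "completely_regular V p" and "a \<in> V" "b \<in> V" "a \<noteq> b"
  shows "norm (p a) = 1" "p a \<noteq> p b" "p a \<noteq> - p b"
proof -
  have "subgraph {a, b} {(Blue, {a, b})} V (complete_edges V)"
    using assms by (auto simp: subgraph_def bicoloured_graph_def intro!: complete_edgesI)
  then have "generic {a, b} {(Blue, {a, b})} p"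
    by (rule completely_regular_generic[OF reg])
  then show "norm (p a) = 1" "p a \<noteq> p b" "p a \<noteq> - p b"
    using assms(4) unfolding generic_def by auto
qed

lemma stress_free_split_regular:
  assumes reg: "completely_regular V p" and sub: "subgraph W (F0 \<union> D) V (complete_edges V)"
    and F0: "F0 \<subseteq> complete_edges (W - {v})" "F0 \<inter> D = {}"
    and v: "v \<in> W" and nb: "\<And>e. e \<in> D \<Longrightarrow> snd e = {v, nb e} \<and> nb e \<in> W - {v}"
    and inj: "inj_on nb D" and D: "D = {ea, eb, ec}" "distinct [ea, eb, ec]"
    and new: "(Blue, {nb ea, nb eb}) \<notin> F0"
    and sf: "stress_free (W - {v}) (insert (Blue, {nb ea, nb eb}) F0) p"
  shows "stress_free W (F0 \<union> D) p"
proof -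
  let ?a = "nb ea" and ?b = "nb eb" and ?c = "nb ec"
  have gr: "bicoloured_graph W (F0 \<union> D)" using sub by (simp add: subgraph_def)
  then have fin: "finite F0" "finite D" "finite W" using bicoloured_graph_finite by blast+
  have WV: "W \<subseteq> V" using sub by (simp add: subgraph_def)
  have abc: "?a \<in> W - {v}" "?b \<in> W - {v}" "?c \<in> W - {v}" using nb D by auto
  have dist: "distinct [?a, ?b, ?c]" using inj D by (auto simp: inj_on_def)
  have "subgraph (W - {v}) F0 V (complete_edges V)"
    using WV fin F0(1) complete_edges_mono[of "W - {v}" V] by (auto simp: subgraph_def bicoloured_graph_def)
  then have gen: "generic (W - {v}) F0 p"
    by (rule completely_regular_generic[OF reg])
  have unit: "norm (p ?a) = 1" "norm (p ?b) = 1" "p ?a \<noteq> p ?b" "p ?a \<noteq> - p ?b"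
    using completely_regular_separated[OF reg, of ?a ?b] completely_regular_separated[OF reg, of ?b ?a]
      abc(1,2)[THEN DiffD1, THEN subsetD[OF WV]] dist by auto
  obtain y where y: "p ?a \<bullet> y = 0" "p ?b \<bullet> y = 0" "p ?c \<bullet> y \<noteq> 0"
    using completely_regular_not_coplanar[OF reg, of ?a ?b ?c] abc WV dist by auto
  define k where "k = 1 / norm (p ?a + p ?b)"
  define z where "z = k *\<^sub>R (p ?a + p ?b)"
  have "p ?a + p ?b \<noteq> 0" using unit(4) by (simp add: add_eq_0_iff2)
  then have k: "k \<noteq> 0" and z: "norm z = 1" by (auto simp: k_def z_def)
  have "stress_free W (F0 \<union> D) (p(v := z))"
    by (rule stress_free_split[OF F0(1) fin(1,2) F0(2) _ D refl refl refl new _ _ sf unit(1-3) y z_def k])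
      (use nb abc in auto)
  moreover have "generic W (F0 \<union> D) (p(v := z))"
  proof (rule generic_fun_upd[OF gen z v nb _ gr])
    have "z \<bullet> y = 0" using y by (simp add: z_def inner_add_left)
    then have c: "p ?c \<noteq> z \<and> p ?c \<noteq> - z" using y(3) by auto
    have lt: "\<bar>p ?a \<bullet> p ?b\<bar> < 1" using unit_inner_abs_less_1 unit by blast
    \<comment> \<open>The chord separates \<open>p ?a\<close> and \<open>p ?b\<close> from
      \<open>z\<close> and \<open>- z\<close>, just as \<open>y\<close> did for
      \<open>p ?c\<close>.\<close>
    have "p ?a \<bullet> (p ?a - p ?b) \<noteq> 0" "p ?b \<bullet> (p ?a - p ?b) \<noteq> 0" "z \<bullet> (p ?a - p ?b) = 0"
      using lt unit(1,2) by (auto simp: z_def algebra_simps inner_commute norm_eq_1)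
    then have "p ?a \<noteq> z \<and> p ?a \<noteq> - z" "p ?b \<noteq> z \<and> p ?b \<noteq> - z"
      by (metis inner_minus_left neg_equal_0_iff_equal)+
    with c show "p (nb e) \<noteq> z \<and> p (nb e) \<noteq> - z" if "e \<in> D" for e
      using that D(1) by blast
  qed auto
  ultimately show ?thesis
    using completely_regular_stress_free[OF reg sub] by blast
qed

text \<open>The placement stays fixed and the graph ranges over all subgraphs of the complete graph,
  because a degree-3 reduction may insert a blue edge that the original graph lacks.\<close>

lemma sparse_imp_stress_free:
  assumes "completely_regular V p" "subgraph W F V (complete_edges V)" "sparse_2_3 W F"
  shows "stress_free W F p"
  using assms(2,3)
proof (induction "card W" arbitrary: W F rule: less_induct)
  case less
  have gr: "bicoloured_graph W F" and WV: "W \<subseteq> V" using less.prems by (auto simp: subgraph_def)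
  then have fin: "finite W" "finite F" using bicoloured_graph_finite by blast+
  show ?case
  proof (cases "F = {}")
    case True
    then show ?thesis by (simp add: independent_on_empty)
  next
    case False
    then obtain v where v: "v \<in> W" "card (star F v) \<le> 3"
      using sparse_low_degree[OF gr less.prems(2)] by blast
    obtain nb where inj: "inj_on nb (star F v)"
      and nb_all: "\<forall>e\<in>star F v. snd e = {v, nb e} \<and> nb e \<in> W - {v}"
      using sparse_star[OF gr less.prems(2) v(1)] by blast
    note nb = bspec[OF nb_all]
    let ?F = "F - star F v"
    have F: "F = ?F \<union> star F v" by (auto simp: star_def)
    have gr': "bicoloured_graph (W - {v}) ?F" by (rule delete_vertex[OF gr])
    have edges: "?F \<subseteq> complete_edges (W - {v})" using gr' by (simp add: bicoloured_graph_def)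
    have smaller: "card (W - {v}) < card W" using v by (intro psubset_card_mono[OF fin(1)]) auto
    have IH: "stress_free (W - {v}) H p"
      if "bicoloured_graph (W - {v}) H" "sparse_2_3 (W - {v}) H" for H
    proof (rule less.hyps[OF smaller _ that(2)])
      show "subgraph (W - {v}) H V (complete_edges V)"
        using that(1) WV complete_edges_mono[of "W - {v}" V] by (auto simp: subgraph_def bicoloured_graph_def)
    qed
    show ?thesis
    proof (cases "card (star F v) \<le> 2")
      case True
      have "sparse_2_3 (W - {v}) ?F"
        by (rule sparse_subgraph[OF less.prems(2)]) (use gr' in \<open>auto simp: subgraph_def\<close>)
      then have "stress_free W (?F \<union> star F v) p"
        using less.prems(1) F
        by (intro stress_free_attach_regular[OF assms(1) _ edges _ IH[OF gr'] v(1) nb inj True]) auto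
      then show ?thesis using F by simp
    next
      case False
      then have c3: "card (star F v) = 3" using v(2) by simp
      then have "card (nb ` star F v) = 3" using inj by (simp add: card_image)
      then obtain a b c where abc: "nb ` star F v = {a, b, c}" "distinct [a, b, c]"
        by (auto simp: card_3_iff)
      obtain x y where xy: "{x, y} \<subseteq> {a, b, c}" "x \<noteq> y" "(Blue, {x, y}) \<notin> ?F"
        "sparse_2_3 (W - {v}) (insert (Blue, {x, y}) ?F)"
        using sparse_split_degree_3[OF gr less.prems(2) v(1) nb abc c3] by blast
      have "x \<in> nb ` star F v" "y \<in> nb ` star F v" using xy(1) abc(1) by auto
      then obtain ex ey where e: "ex \<in> star F v" "nb ex = x" "ey \<in> star F v" "nb ey = y" by auto
      have "ex \<noteq> ey" using e xy(2) by auto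
      then have "card (star F v - {ex, ey}) = 1"
        using c3 e by (subst card_Diff_subset) auto
      then obtain ez where "star F v - {ex, ey} = {ez}" by (auto simp: card_1_singleton_iff)
      then have D: "star F v = {ex, ey, ez}" "distinct [ex, ey, ez]" using e xy(2) by auto
      have "bicoloured_graph (W - {v}) (insert (Blue, {nb ex, nb ey}) ?F)"
        using gr' nb[OF e(1)] nb[OF e(3)] complete_edgesI[of "nb ex" "W - {v}" "nb ey"]
        by (simp add: bicoloured_graph_def)
      then have "stress_free (W - {v}) (insert (Blue, {nb ex, nb ey}) ?F) p"
        using IH xy(4) e by simp
      then have "stress_free W (?F \<union> star F v) p"
        using less.prems(1) F xy(3) e
        by (intro stress_free_split_regular[OF assms(1) _ edges _ v(1) nb inj D]) auto
      then show ?thesis using F by simp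
    qed
  qed
qed

section \<open>Counting\<close>

lemma inner_eq_sum_coordinates:
  fixes u :: "'v \<Rightarrow> real ^ 3"
  assumes "finite V" "x \<in> V"
  shows "y \<bullet> u x = (\<Sum>j\<in>V \<times> UNIV. (if fst j = x then y $ snd j else 0) * u (fst j) $ snd j)"
proof -
  have "(\<Sum>j\<in>V \<times> UNIV. (if fst j = x then y $ snd j else 0) * u (fst j) $ snd j)
    = (\<Sum>v\<in>V. \<Sum>i\<in>UNIV. (if v = x then y $ i else 0) * u v $ i)"
    by (simp add: sum.cartesian_product case_prod_beta)
  also have "\<dots> = (\<Sum>v\<in>V. if v = x then y \<bullet> u x else 0)"
    by (intro sum.cong) (auto simp: inner_vec_def)
  finally show ?thesis using assms by simp
qed

lemma inner_in_coordinate_span: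
  assumes "finite V" "x \<in> V"
  shows "\<exists>c. \<forall>u::'v \<Rightarrow> real ^ 3. y \<bullet> u x = (\<Sum>j\<in>V \<times> UNIV. c j * u (fst j) $ snd j)"
  by (rule exI, rule allI, rule inner_eq_sum_coordinates[OF assms])

lemma pair_rate_in_coordinate_span:
  assumes "finite V" "v \<in> V" "w \<in> V"
  shows "\<exists>c. \<forall>u. pair_rate p u {v, w} = (\<Sum>j\<in>V \<times> UNIV. c j * u (fst j) $ snd j)"
  by (rule exI[of _ "\<lambda>j. (if fst j = w then p v $ snd j else 0) + (if fst j = v then p w $ snd j else 0)"])
    (simp only: pair_rate_pair inner_eq_sum_coordinates[OF assms(1,2)]
      inner_eq_sum_coordinates[OF assms(1,3)] distrib_right sum.distrib simp_thms)

text \<open>The rates of the edges are completed by the radial components, which vanish on tangent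
  fields, and by three gauge functionals, which vanish on no nontrivial rotation.\<close>

definition gauged_rate ::
    "('v \<Rightarrow> real ^ 3) \<Rightarrow> 'v \<Rightarrow> 'v \<Rightarrow> 'v edge + 'v + nat \<Rightarrow> ('v \<Rightarrow> real ^ 3) \<Rightarrow> real" where
  "gauged_rate p a b = case_sum (\<lambda>e u. pair_rate p u (snd e)) (case_sum (\<lambda>v u. p v \<bullet> u v)
    (\<lambda>i u. if i = 0 then p b \<bullet> u a else if i = 1 then cross3 (p a) (p b) \<bullet> u a
      else cross3 (p a) (p b) \<bullet> u b))"

definition gauged_index :: "'v set \<Rightarrow> 'v edge set \<Rightarrow> ('v edge + 'v + nat) set" where
  "gauged_index V E = E <+> (V <+> {..<3})"

lemma card_gauged_index:
  "finite V \<Longrightarrow> finite E \<Longrightarrow> card (gauged_index V E) = card E + card V + 3"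
  by (simp add: gauged_index_def card_Plus)

lemma finite_gauged_index:
  "finite V \<Longrightarrow> finite E \<Longrightarrow> finite (gauged_index V E)"
  by (simp add: gauged_index_def)

lemma gauge_in_gauged_index: "Inr (Inr k) \<in> gauged_index V E \<longleftrightarrow> k < 3"
  by (auto simp: gauged_index_def)

lemma sum_gauged_rate:
  assumes "finite V" "finite E"
  shows "(\<Sum>i\<in>gauged_index V E. s i * gauged_rate p a b i u)
    = (\<Sum>e\<in>E. s (Inl e) * pair_rate p u (snd e)) + (\<Sum>v\<in>V. s (Inr (Inl v)) * (p v \<bullet> u v))
      + (\<Sum>i<3. s (Inr (Inr i)) * gauged_rate p a b (Inr (Inr i)) u)"
  using assms unfolding gauged_index_def by (simp add: sum.Plus gauged_rate_def)

lemma gauged_rate_in_coordinate_span: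
  assumes "finite V" "E \<subseteq> complete_edges V" "a \<in> V" "b \<in> V" "i \<in> gauged_index V E"
  shows "\<exists>c. \<forall>u. gauged_rate p a b i u = (\<Sum>j\<in>V \<times> UNIV. c j * u (fst j) $ snd j)"
proof -
  consider (edge) e where "i = Inl e" "e \<in> E" | (radial) v where "i = Inr (Inl v)" "v \<in> V"
    | (gauge) k where "i = Inr (Inr k)"
    using assms(5) by (auto simp: gauged_index_def)
  then show ?thesis
  proof cases
    case edge
    then have "e \<in> complete_edges V" using assms(2) by blast
    then obtain c v w where "e = (c, {v, w})" "v \<in> V" "w \<in> V" by (rule complete_edgesE)
    then show ?thesis
      using pair_rate_in_coordinate_span[OF assms(1)] edge by (simp add: gauged_rate_def del: pair_rate_pair)
  next
    case radial
    then show ?thesis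
      using inner_in_coordinate_span[OF assms(1)] by (simp add: gauged_rate_def)
  next
    case gauge
    then show ?thesis
      using inner_in_coordinate_span[OF assms(1,3)] inner_in_coordinate_span[OF assms(1,4)]
      by (cases "k = 0"; cases "k = 1") (simp_all add: gauged_rate_def)
  qed
qed

definition rotation_field :: "('v \<Rightarrow> real ^ 3) \<Rightarrow> real ^ 3 \<Rightarrow> 'v \<Rightarrow> real ^ 3" where
  "rotation_field p \<omega> v = cross3 \<omega> (p v)"

lemma rotation_field_tangent: "p v \<bullet> rotation_field p \<omega> v = 0"
  by (simp add: rotation_field_def dot_cross_self)

lemma pair_rate_rotation_field: "pair_rate p (rotation_field p \<omega>) e = 0"
  by (simp add: pair_rate_def rotation_field_def cross3_simps split: prod.split)

lemma gauge_rotation_field_zero: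
  assumes n: "cross3 (p a) (p b) \<noteq> 0"
    and s: "\<And>\<omega>. (\<Sum>i<3. s i * gauged_rate p a b (Inr (Inr i)) (rotation_field p \<omega>)) = 0"
    and "i < 3"
  shows "s i = 0"
proof -
  let ?n = "cross3 (p a) (p b)"
  \<comment> \<open>By the scalar triple product, the gauge sum on the rotation with angular
    velocity \<open>\<omega>\<close> is \<open>\<omega> \<bullet> t\<close>. The normal part of
    \<open>t\<close> yields \<open>s 0\<close>, and its part in the plane yields the other
    two.\<close>
  define t where "t = s 0 *\<^sub>R ?n + cross3 (s 1 *\<^sub>R p a + s 2 *\<^sub>R p b) ?n"
  have "\<omega> \<bullet> t = 0" for \<omega>
  proof -
    have "\<omega> \<bullet> t = s 0 * (p b \<bullet> cross3 \<omega> (p a)) + s 1 * (?n \<bullet> cross3 \<omega> (p a)) + s 2 * (?n \<bullet> cross3 \<omega> (p b))"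
      unfolding t_def by (simp add: cross3_simps)
    then show ?thesis
      using s[of \<omega>] by (simp add: gauged_rate_def rotation_field_def lessThan_Suc eval_nat_numeral)
  qed
  then have "t = 0" using inner_eq_zero_iff by blast
  have "?n \<bullet> t = s 0 * (?n \<bullet> ?n)"
    unfolding t_def by (simp add: inner_add_right dot_cross_self)
  then have s0: "s 0 = 0" using \<open>t = 0\<close> n by simp
  let ?w = "s 1 *\<^sub>R p a + s 2 *\<^sub>R p b"
  have "?w \<bullet> ?n = 0" by (simp add: inner_add_left dot_cross_self)
  moreover have "cross3 ?w ?n = 0" using \<open>t = 0\<close> s0 by (simp add: t_def)
  ultimately have w: "?w = 0" using n norm_and_cross_eq_0 by blast
  have "cross3 (p a) ?w = s 2 *\<^sub>R ?n" "cross3 ?w (p b) = s 1 *\<^sub>R ?n"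
    by (simp_all add: cross_add_left cross_add_right cross_mult_left cross_mult_right)
  then have "s 1 = 0" "s 2 = 0" using w n by auto
  moreover have "i = 0 \<or> i = 1 \<or> i = 2" using assms(3) by auto
  ultimately show ?thesis using s0 by blast
qed

text \<open>Three kinds of test fields separate the coefficients: rotations see only the gauges,
  tangent fields then only the edges, and a radial field at one vertex isolates its radial
  coefficient.\<close>

lemma gauged_rate_independent:
  assumes "finite V" "finite E" "stress_free V E p"
    and unit: "\<And>v. v \<in> V \<Longrightarrow> norm (p v) = 1" and n: "cross3 (p a) (p b) \<noteq> 0"
  shows "independent_on UNIV (gauged_index V E) (gauged_rate p a b)"
  unfolding independent_on_def
proof (intro allI impI)
  fix s assume s: "\<forall>u\<in>UNIV. (\<Sum>i\<in>gauged_index V E. s i * gauged_rate p a b i u) = 0"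
  have eq: "(\<Sum>e\<in>E. s (Inl e) * pair_rate p u (snd e)) + (\<Sum>v\<in>V. s (Inr (Inl v)) * (p v \<bullet> u v))
      + (\<Sum>i<3. s (Inr (Inr i)) * gauged_rate p a b (Inr (Inr i)) u) = 0" for u
    using s by (simp add: sum_gauged_rate[OF assms(1,2)])
  have "(\<Sum>i<3. s (Inr (Inr i)) * gauged_rate p a b (Inr (Inr i)) (rotation_field p \<omega>)) = 0" for \<omega>
    using eq[of "rotation_field p \<omega>"] by (simp add: pair_rate_rotation_field rotation_field_tangent)
  then have gauge: "s (Inr (Inr i)) = 0" if "i < 3" for i
    by (rule gauge_rotation_field_zero[where s = "\<lambda>i. s (Inr (Inr i))" and p = p and a = a and b = b, OF n _ that])
  have edge: "s (Inl e) = 0" if "e \<in> E" for e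
  proof (rule independent_onD[OF assms(3) _ that, of "\<lambda>e. s (Inl e)"])
    fix u assume "u \<in> tangent_fields V p"
    then show "(\<Sum>e\<in>E. s (Inl e) * pair_rate p u (snd e)) = 0"
      using eq[of u] gauge by (simp add: tangent_fields_def)
  qed
  have radial: "s (Inr (Inl v)) = 0" if "v \<in> V" for v
  proof -
    have "(\<Sum>w\<in>V. s (Inr (Inl w)) * (p w \<bullet> (if w = v then p v else 0)))
        = (\<Sum>w\<in>V. if w = v then s (Inr (Inl v)) else 0)"
      using unit[OF that] by (intro sum.cong) (auto simp: norm_eq_1)
    then show ?thesis
      using eq[of "\<lambda>w. if w = v then p v else 0"] edge gauge assms(1) that by simp
  qed
  show "\<forall>i\<in>gauged_index V E. s i = 0"
    using edge radial gauge by (auto simp: gauged_index_def)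
qed

lemma cross3_nonzero:
  assumes "norm x = 1" "norm y = 1" "x \<noteq> y" "x \<noteq> - y"
  shows "cross3 x y \<noteq> 0"
proof
  assume "cross3 x y = 0"
  then have "(x \<bullet> y)\<^sup>2 = 1" using norm_cross_dot[of x y] assms by simp
  then show False
    using unit_inner_abs_less_1[OF assms] by (metis abs_square_less_1 less_irrefl)
qed

lemma card_coordinates: "finite V \<Longrightarrow> card (V \<times> (UNIV :: 3 set)) = 3 * card V"
  by (simp add: card_cartesian_product)

text \<open>There are |F| + |W| + 3 independent functionals in a span of at most 3|W| coordinates.
  The second vertex is needed to define the gauges.\<close>

lemma stress_free_card_le:
  assumes reg: "completely_regular V p" and sub: "subgraph W F V (complete_edges V)"
    and sf: "stress_free W F p" and "2 \<le> card W"
  shows "card F + 3 \<le> 2 * card W"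
proof -
  have fin: "finite W" "finite F" and F: "F \<subseteq> complete_edges W" and WV: "W \<subseteq> V"
    using sub bicoloured_graph_finite[of W F] by (auto simp: subgraph_def bicoloured_graph_def)
  have "\<not> (\<forall>a\<in>W. \<forall>b\<in>W. a = b)"
    using assms(4) card_le_Suc0_iff_eq[OF fin(1)] by auto
  then obtain a b where ab: "a \<in> W" "b \<in> W" "a \<noteq> b" by blast
  have unit: "norm (p v) = 1" if "v \<in> W" for v
    using completely_regular_generic[OF reg sub] that by (auto simp: generic_def)
  have n: "cross3 (p a) (p b) \<noteq> 0"
    using completely_regular_separated[OF reg, of a b] ab WV unit by (intro cross3_nonzero) auto
  have "card (gauged_index W F) \<le> card (W \<times> (UNIV :: 3 set))"
    by (rule independent_family_card_le[OF finite_gauged_index[OF fin] _ gauged_rate_independent[OF fin sf unit n]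
          gauged_rate_in_coordinate_span[OF fin(1) F ab(1,2)]]) (use fin in auto)
  then show ?thesis
    using fin by (simp add: card_gauged_index card_coordinates)
qed

text \<open>After removal of its component along the normal, \<open>x\<close> is both orthogonal and
  parallel to the normal, hence 0.\<close>

lemma orthogonal_to_plane:
  fixes x a b :: "real ^ 3"
  assumes "x \<bullet> a = 0" "x \<bullet> b = 0" "cross3 a b \<noteq> 0"
  shows "\<exists>k. x = k *\<^sub>R cross3 a b"
proof -
  let ?n = "cross3 a b" and ?d = "\<lambda>k. x - k *\<^sub>R cross3 a b"
  define k where "k = (x \<bullet> ?n) / (?n \<bullet> ?n)"
  have "cross3 x ?n = (x \<bullet> b) *\<^sub>R a - (x \<bullet> a) *\<^sub>R b"
    by (simp add: cross3_simps forall_3)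
  then have "cross3 (?d k) ?n = 0"
    using assms(1,2) by (simp add: Cross3.left_diff_distrib cross_mult_left)
  moreover have "?d k \<bullet> ?n = 0"
    using assms(3) by (simp add: k_def inner_diff_left)
  ultimately have "?d k = 0" using assms(3) norm_and_cross_eq_0 by blast
  then show ?thesis by auto
qed

text \<open>The gauges remove the rotations: they force \<open>u a = 0\<close>, then
  \<open>u b = 0\<close>. Any other \<open>u v\<close> is then orthogonal to \<open>p a\<close>,
  \<open>p b\<close> and \<open>p v\<close>, which are linearly independent by
  \<open>completely_regular_not_coplanar\<close>.\<close>

lemma complete_flex_gauge_zero:
  assumes reg: "completely_regular V p" and ab: "a \<in> V" "b \<in> V" "a \<noteq> b"
    and tangent: "\<And>v. v \<in> V \<Longrightarrow> p v \<bullet> u v = 0"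
    and flex: "\<And>v w. v \<in> V \<Longrightarrow> w \<in> V \<Longrightarrow> p v \<bullet> u w + p w \<bullet> u v = 0"
    and gauge: "p b \<bullet> u a = 0" "cross3 (p a) (p b) \<bullet> u a = 0" "cross3 (p a) (p b) \<bullet> u b = 0"
    and "v \<in> V"
  shows "u v = 0"
proof -
  let ?n = "cross3 (p a) (p b)"
  have n: "?n \<noteq> 0"
    using completely_regular_separated[OF reg, of a b] completely_regular_separated[OF reg, of b a] ab
    by (intro cross3_nonzero) auto
  have zero: "x = 0" if "p a \<bullet> x = 0" "p b \<bullet> x = 0" "z \<bullet> x = 0" "z \<bullet> ?n \<noteq> 0" for x z
  proof -
    have "x \<bullet> p a = 0" "x \<bullet> p b = 0" using that(1,2) by (simp_all add: inner_commute)
    from orthogonal_to_plane[OF this n] obtain k where k: "x = k *\<^sub>R ?n" ..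
    then have "k = 0" using that(3,4) by simp
    then show ?thesis using k by simp
  qed
  have ua: "u a = 0"
    by (rule zero[of _ ?n]) (use gauge tangent[OF ab(1)] n in simp_all)
  have ub: "u b = 0"
    by (rule zero[of _ ?n]) (use gauge tangent[OF ab(2)] flex[OF ab(1,2)] ua n in simp_all)
  show ?thesis
  proof (cases "v = a \<or> v = b")
    case True
    then show ?thesis using ua ub by blast
  next
    case False
    then obtain y where y: "p a \<bullet> y = 0" "p b \<bullet> y = 0" "p v \<bullet> y \<noteq> 0"
      using completely_regular_not_coplanar[OF reg, of a b v] ab \<open>v \<in> V\<close> by auto
    have "y \<bullet> p a = 0" "y \<bullet> p b = 0" using y(1,2) by (simp_all add: inner_commute)
    from orthogonal_to_plane[OF this n] obtain k where "y = k *\<^sub>R ?n" ..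
    then have nv: "p v \<bullet> ?n \<noteq> 0" using y(3) by auto
    show ?thesis
      by (rule zero[of _ "p v"])
        (use flex[OF ab(1) \<open>v \<in> V\<close>] flex[OF ab(2) \<open>v \<in> V\<close>] ua ub tangent[OF \<open>v \<in> V\<close>] nv in simp_all)
  qed
qed

lemma inf_flex_iff:
  assumes gen: "generic V (complete_edges V) p" and "E \<subseteq> complete_edges V"
  shows "inf_flex V E p u \<longleftrightarrow> u \<in> tangent_fields V p \<and> (\<forall>e\<in>E. pair_rate p u (snd e) = 0)"
proof -
  obtain k where k: "\<forall>e\<in>complete_edges V. k e \<noteq> 0 \<and>
      (\<forall>u\<in>tangent_fields V p. separation_rate p u e = k e * pair_rate p u (snd e))"
    using generic_separation_rate[OF gen] ..
  have "separation_rate p u e = 0 \<longleftrightarrow> pair_rate p u (snd e) = 0"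
    if "u \<in> tangent_fields V p" "e \<in> E" for e
    using k that assms(2) by auto
  then show ?thesis unfolding inf_flex_def by blast
qed

theorem theorem3p1:
  fixes V :: "'v set" and E :: "'v edge set" and p :: "'v \<Rightarrow> real ^ 3"
  assumes "bicoloured_graph V E"
    and "card V \<ge> 2"
    and "framework V E p"
    and "completely_regular V p"
  shows "minimally_rigid V E p \<longleftrightarrow> tight_2_3 V E"
proof -
  have fin: "finite V" "finite E" and E: "E \<subseteq> complete_edges V"
    using assms(1) bicoloured_graph_finite[of V E] by (auto simp: bicoloured_graph_def)
  have sub: "subgraph V (complete_edges V) V (complete_edges V)" "subgraph V E V (complete_edges V)"
    using fin E by (auto simp: subgraph_def bicoloured_graph_def)
  have gen: "generic V (complete_edges V) p"
    by (rule completely_regular_generic[OF assms(4) sub(1)])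
  note flex_iff = inf_flex_iff[OF gen]
  have unit: "norm (p v) = 1" if "v \<in> V" for v
    using gen that by (auto simp: generic_def)
  have "\<not> (\<forall>a\<in>V. \<forall>b\<in>V. a = b)"
    using assms(2) card_le_Suc0_iff_eq[OF fin(1)] by auto
  then obtain a b where ab: "a \<in> V" "b \<in> V" "a \<noteq> b" by blast
  have n: "cross3 (p a) (p b) \<noteq> 0"
    using completely_regular_separated[OF assms(4), of a b] ab unit by (intro cross3_nonzero) auto
  let ?I = "gauged_index V E" and ?R = "gauged_rate p a b"
  let ?C = "\<lambda>j (u :: 'v \<Rightarrow> real ^ 3). u (fst j) $ snd j"
  have R_linear: "?R i (\<lambda>x. u x + k *\<^sub>R w x) = ?R i u + k * ?R i w" for i u k w
    by (auto simp: gauged_rate_def pair_rate_linear inner_add_right split: sum.split)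
  show ?thesis
  proof
    assume min: "minimally_rigid V E p"
    then have rigid: "rigid V E p" and min': "\<And>e. e \<in> E \<Longrightarrow> \<not> rigid V (E - {e}) p"
      by (auto simp: minimally_rigid_def)
    \<comment> \<open>An edge with nonzero stress has its row determined by the others, so deleting
      it would preserve rigidity.\<close>
    have sf: "stress_free V E p"
      unfolding independent_on_def
    proof (intro allI impI ballI, rule ccontr)
      fix s e assume s: "\<forall>u\<in>tangent_fields V p. (\<Sum>e\<in>E. s e * pair_rate p u (snd e)) = 0"
        and e: "e \<in> E" "s e \<noteq> 0"
      have "inf_flex V (complete_edges V) p u" if "inf_flex V (E - {e}) p u" for u
      proof -
        have u: "u \<in> tangent_fields V p" "\<forall>e'\<in>E - {e}. pair_rate p u (snd e') = 0"
          using that flex_iff[of "E - {e}"] E by blast+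
        then have "s e * pair_rate p u (snd e) = 0"
          using bspec[OF s u(1)] by (simp add: sum.remove[OF fin(2) e(1)])
        then have "inf_flex V E p u"
          using u e(2) flex_iff[OF E] by auto
        then show ?thesis using rigid by (simp add: rigid_def)
      qed
      then show False using min'[OF e(1)] by (simp add: rigid_def)
    qed
    have "sparse_2_3 V E"
      unfolding sparse_2_3_def
    proof (intro allI impI, elim conjE)
      fix V' E' assume sub': "subgraph V' E' V E" and pos: "0 < card E'"
      have V': "V' \<subseteq> V" "E' \<subseteq> E" "E' \<subseteq> complete_edges V'" "finite V'"
        using sub' by (auto simp: subgraph_def bicoloured_graph_def)
      have sf': "stress_free V' E' p"
        unfolding independent_on_def
      proof (intro allI impI)
        fix s assume s: "\<forall>u\<in>tangent_fields V' p. (\<Sum>e\<in>E'. s e * pair_rate p u (snd e)) = 0"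
        let ?s = "\<lambda>e. if e \<in> E' then s e else 0"
        have "(\<Sum>e\<in>E. ?s e * pair_rate p u (snd e)) = 0" if "u \<in> tangent_fields V p" for u
        proof -
          have "u \<in> tangent_fields V' p" using that V'(1) by (auto simp: tangent_fields_def)
          moreover have "(\<Sum>e\<in>E. ?s e * pair_rate p u (snd e)) = (\<Sum>e\<in>E'. s e * pair_rate p u (snd e))"
            using V'(2) fin(2) by (intro sum.mono_neutral_cong_right) auto
          ultimately show ?thesis using s by simp
        qed
        then have "?s e = 0" if "e \<in> E" for e
          using independent_onD[OF sf, of ?s] that by simp
        then show "\<forall>e\<in>E'. s e = 0" using V'(2) by (metis subsetD)
      qed
      have "E' \<noteq> {}" using pos by auto
      then obtain e where e: "e \<in> E'" by blast
      then have "e \<in> complete_edges V'" using V'(3) by blast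
      then obtain c v w where vw: "e = (c, {v, w})" "v \<in> V'" "w \<in> V'" by (rule complete_edgesE)
      have "finite E'" using V'(2) fin(2) finite_subset by blast
      then obtain u where "u \<in> tangent_fields V' p" "pair_rate p u (snd e) \<noteq> 0"
        using stress_free_dual_field[OF _ sf' e] by blast
      \<comment> \<open>A loop has a zero row, which no stress-free graph contains; hence
        \<open>V'\<close> has the two vertices required by the count.\<close>
      then have "v \<noteq> w" using vw by (auto simp: tangent_fields_def)
      then have "2 \<le> card V'" using vw V'(4) card_mono[of V' "{v, w}"] by simp
      moreover have "subgraph V' E' V (complete_edges V)"
        using sub' E by (auto simp: subgraph_def)
      ultimately have "card E' + 3 \<le> 2 * card V'"
        using stress_free_card_le[OF assms(4) _ sf'] by blast
      then show "int (card E') \<le> 2 * int (card V') - 3" by linarith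
    qed
    \<comment> \<open>A field on which all gauged functionals vanish is a flex, by rigidity a flex
      of \<open>K(V)\<close>, and so 0 on \<open>V\<close>. Therefore these functionals span all
      3|V| coordinates.\<close>
    moreover have "3 * card V \<le> card E + card V + 3"
    proof -
      have vanish: "u v = 0" if R0: "\<And>i. i \<in> ?I \<Longrightarrow> ?R i u = 0" and v: "v \<in> V" for u v
      proof -
        have t: "u \<in> tangent_fields V p"
          using R0[of "Inr (Inl _)"] by (auto simp: tangent_fields_def gauged_index_def gauged_rate_def)
        have "\<forall>e\<in>E. pair_rate p u (snd e) = 0"
          using R0[of "Inl _"] by (auto simp: gauged_index_def gauged_rate_def)
        then have "inf_flex V (complete_edges V) p u"
          using t flex_iff[OF E] rigid by (simp add: rigid_def)
        then have flex: "pair_rate p u (snd e) = 0" if "e \<in> complete_edges V" for e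
          using flex_iff[OF order_refl] that by simp
        show ?thesis
        proof (rule complete_flex_gauge_zero[OF assms(4) ab _ _ _ _ _ v])
          show "p v \<bullet> u v = 0" if "v \<in> V" for v using t that by (simp add: tangent_fields_def)
          show "p v \<bullet> u w + p w \<bullet> u v = 0" if "v \<in> V" "w \<in> V" for v w
            using flex[OF complete_edgesI[OF that, of Blue]] by simp
          show "p b \<bullet> u a = 0" "cross3 (p a) (p b) \<bullet> u a = 0" "cross3 (p a) (p b) \<bullet> u b = 0"
            using R0[of "Inr (Inr 0)"] R0[of "Inr (Inr 1)"] R0[of "Inr (Inr 2)"]
            by (simp_all add: gauge_in_gauged_index gauged_rate_def)
        qed
      qed
      have "card (V \<times> (UNIV :: 3 set)) \<le> card ?I"
      proof (rule independent_family_card_le[of _ _ ?C ?R])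
        show "independent_on UNIV (V \<times> UNIV) ?C"
          unfolding independent_on_def
        proof (intro allI impI ballI)
          fix s :: "'v \<times> 3 \<Rightarrow> real" and j
          assume s: "\<forall>u\<in>UNIV. (\<Sum>j\<in>V \<times> UNIV. s j * ?C j u) = 0" and j: "j \<in> V \<times> (UNIV :: 3 set)"
          have "(\<Sum>j'\<in>V \<times> UNIV. s j' * ?C j' (\<lambda>v. if v = fst j then axis (snd j) 1 else 0))
            = (\<Sum>j'\<in>V \<times> UNIV. if j' = j then s j else 0)"
            by (intro sum.cong) (auto simp: axis_def)
          then show "s j = 0"
            using bspec[OF s, of "\<lambda>v. if v = fst j then axis (snd j) 1 else 0"] j fin(1) by simp
        qed
        show "\<exists>c. \<forall>u. ?C j u = (\<Sum>i\<in>?I. c i * ?R i u)" if "j \<in> V \<times> UNIV" for j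
        proof -
          have "\<exists>c. \<forall>u\<in>UNIV. ?C j u = (\<Sum>i\<in>?I. c i * ?R i u)"
          proof (rule functional_in_span_if_kernel[OF finite_gauged_index[OF fin]])
            show "?C j u = 0" if "\<And>i. i \<in> ?I \<Longrightarrow> ?R i u = 0" for u
              using vanish[of u "fst j"] that \<open>j \<in> V \<times> UNIV\<close> by auto
          qed (use R_linear in auto)
          then show ?thesis by simp
        qed
      qed (use fin finite_gauged_index in auto)
      then show ?thesis using fin by (simp add: card_coordinates card_gauged_index)
    qed
    moreover have "card E + 3 \<le> 2 * card V"
      by (rule stress_free_card_le[OF assms(4) sub(2) sf assms(2)])
    ultimately show "tight_2_3 V E"
      unfolding tight_2_3_def by linarith
  next
    assume tight: "tight_2_3 V E"
    then have sf: "stress_free V E p"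
      using sparse_imp_stress_free[OF assms(4) sub(2)] by (simp add: tight_2_3_def)
    \<comment> \<open>Tightness makes the gauged system square, so independence turns into
      spanning.\<close>
    have card: "card ?I = card (V \<times> (UNIV :: 3 set))"
      using tight fin by (simp add: tight_2_3_def card_gauged_index card_coordinates)
    note ind = gauged_rate_independent[OF fin sf unit n]
    have "rigid V E p"
      unfolding rigid_def
    proof (intro allI impI)
      fix u assume "inf_flex V E p u"
      then have u: "u \<in> tangent_fields V p" "\<forall>e\<in>E. pair_rate p u (snd e) = 0"
        using flex_iff[OF E] by auto
      have "pair_rate p u (snd f) = 0" if f: "f \<in> complete_edges V" for f
      proof -
        obtain c v w where vw: "f = (c, {v, w})" "v \<in> V" "w \<in> V" using f by (rule complete_edgesE)
        have "\<exists>c. \<forall>u\<in>UNIV. pair_rate p u (snd f) = (\<Sum>i\<in>?I. c i * ?R i u)"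
        proof (rule functional_in_span_if_kernel[OF finite_gauged_index[OF fin]])
          fix u assume R0: "\<And>i. i \<in> ?I \<Longrightarrow> ?R i u = 0"
          have "?C j u = 0" if "j \<in> V \<times> UNIV" for j
            by (rule independent_family_spans[OF finite_gauged_index[OF fin] _ ind _ card that])
              (use fin R0 gauged_rate_in_coordinate_span[OF fin(1) E ab(1,2)] in auto)
          then have "u x = 0" if "x \<in> V" for x
            using that by (auto simp: vec_eq_iff)
          then show "pair_rate p u (snd f) = 0" using vw by simp
        qed (use R_linear pair_rate_linear in auto)
        then obtain c where "pair_rate p u (snd f) = (\<Sum>i\<in>?I. c i * ?R i u)" for u
          by blast
        then have eq: "pair_rate p u (snd f) = (\<Sum>e\<in>E. c (Inl e) * pair_rate p u (snd e))
            + (\<Sum>v\<in>V. c (Inr (Inl v)) * (p v \<bullet> u v))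
            + (\<Sum>i<3. c (Inr (Inr i)) * gauged_rate p a b (Inr (Inr i)) u)" for u
          by (simp only: sum_gauged_rate[OF fin])
        \<comment> \<open>All pair rates vanish on rotations, so no gauge enters the expansion of
          \<open>f\<close>. Its remaining terms vanish on every flex of \<open>E\<close>.\<close>
        have "(\<Sum>i<3. c (Inr (Inr i)) * gauged_rate p a b (Inr (Inr i)) (rotation_field p \<omega>)) = 0" for \<omega>
          using eq[of "rotation_field p \<omega>"] by (simp add: pair_rate_rotation_field rotation_field_tangent)
        then have "c (Inr (Inr i)) = 0" if "i < 3" for i
          by (rule gauge_rotation_field_zero[where s = "\<lambda>i. c (Inr (Inr i))" and p = p and a = a and b = b, OF n _ that])
        then show ?thesis
          using eq[of u] u by (simp add: tangent_fields_def)
      qed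
      then show "inf_flex V (complete_edges V) p u"
        using flex_iff[OF order_refl] u(1) by blast
    qed
    moreover have "\<not> rigid V (E - {e}) p" if e: "e \<in> E" for e
    proof
      assume r: "rigid V (E - {e}) p"
      obtain u where u: "u \<in> tangent_fields V p" "\<forall>e'\<in>E - {e}. pair_rate p u (snd e') = 0"
        "pair_rate p u (snd e) \<noteq> 0"
        using stress_free_dual_field[OF fin(2) sf e] by blast
      then have "inf_flex V (E - {e}) p u"
        using flex_iff[of "E - {e}"] E by blast
      then have "inf_flex V (complete_edges V) p u" using r by (simp add: rigid_def)
      then show False
        using u(3) flex_iff[OF order_refl] E e by blast
    qed
    ultimately show "minimally_rigid V E p"
      by (simp add: minimally_rigid_def)
  qed
qed

end
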